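(* There exist absolute constants $C>0$ and an algorithm ($\mathtt{MultiLFHT}$) with the following guarantee. Let $k\ge 2$, $n\ge 1$, $\varepsilon\in(0,1]$, and let $P,Q$ be distributions on $[n]$ with $\mathrm{d_{TV}}(P,Q)\ge\varepsilon$. Given $n,k,\varepsilon$, sample access to $P$ and to $Q$, and sample access to distributions $D_1,\dots,D_k$ on $[n]$ each of which is promised to equal either $P$ or $Q$, the algorithm outputs, with probability at least $8/9$, the correct label ($P$ or $Q$) for every $D_i$ simultaneously. The total number of samples drawn (from $P$, $Q$ and all $D_i$ together) is at most $C$ times $$\begin{cases} \left(\frac{n^2k\log k}{\varepsilon^4}\right)^{1/3} & \text{if } n \ge \frac{k\log k}{\varepsilon^4},\\[1ex] \frac{\sqrt{nk\log k}}{\varepsilon^2} & \text{if } k\log k \le n \le \frac{k\log k}{\varepsilon^4},\\[1ex] \frac{k\log k}{\varepsilon^2} & \text{if } n \le k\log k. \end{cases}$$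
   Context: $\mathrm{d_{TV}}(D_1,D_2)=\frac12\sum_{i\in[n]}|D_1(i)-D_2(i)|$ is the total variation distance between distributions on $[n]=\{1,\dots,n\}$. "Sample access" to a distribution means the algorithm may request, at any time and adaptively, independent samples from it; the sample complexity is the total number of samples requested. *)

theory Defs
  imports "HOL-Probability.Probability"
begin

definition dTV :: "nat \<Rightarrow> nat pmf \<Rightarrow> nat pmf \<Rightarrow> real" where
  "dTV n D1 D2 = (1/2) * (\<Sum>i\<in>{1..n}. \<bar>pmf D1 i - pmf D2 i\<bar>)"

datatype source = SrcP | SrcQ | SrcD nat

text \<open>A deterministic adaptive sampling algorithm: either stop with an output,
  or request one sample from a source and continue depending on the sample.
  A randomized algorithm is a probability distribution over such trees
  (its internal randomness drawn up front).\<close>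
datatype ('s, 'o) qtree = Done 'o | Ask 's "nat \<Rightarrow> ('s, 'o) qtree"

primrec run :: "('s \<Rightarrow> nat pmf) \<Rightarrow> ('s, 'o) qtree \<Rightarrow> 'o pmf" where
  "run env (Done r) = return_pmf r"
| "run env (Ask s f) = bind_pmf (env s) (\<lambda>x. run env (f x))"

primrec within_samples :: "('s, 'o) qtree \<Rightarrow> real \<Rightarrow> bool" where
  "within_samples (Done r) b = True"
| "within_samples (Ask s f) b = (1 \<le> b \<and> (\<forall>x. within_samples (f x) (b - 1)))"

definition sc_bound :: "nat \<Rightarrow> nat \<Rightarrow> real \<Rightarrow> real" where
  "sc_bound n k \<epsilon> =
     (if real n \<ge> real k * ln (real k) / \<epsilon> ^ 4
      then (real n ^ 2 * real k * ln (real k) / \<epsilon> ^ 4) powr (1/3)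
      else if real k * ln (real k) \<le> real n
      then sqrt (real n * real k * ln (real k)) / \<epsilon> ^ 2
      else real k * ln (real k) / \<epsilon> ^ 2)"

definition env_of :: "nat pmf \<Rightarrow> nat pmf \<Rightarrow> (nat \<Rightarrow> nat pmf) \<Rightarrow> source \<Rightarrow> nat pmf" where
  "env_of P Q D s = (case s of SrcP \<Rightarrow> P | SrcQ \<Rightarrow> Q | SrcD i \<Rightarrow> D i)"

end

theory Submission
  imports Defs
begin

text \<open>
  Draw \<open>s\<close> labelled samples, each from \<open>P\<close> or from \<open>Q\<close> according to a fair coin, and let \<open>f i\<close> be the
  sign of the majority label among the samples with value \<open>i\<close> (\<open>0\<close> on ties).  If the gap
  \<open>E\<^sub>P f - E\<^sub>Q f\<close> is at least \<open>\<gamma>\<close>, then, as \<open>f\<close> is bounded by \<open>1\<close>, Hoeffding's inequality lets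
  \<open>O(log k / \<gamma>\<^sup>2)\<close> samples from each of \<open>P, Q, D\<^sub>1, \<dots>, D\<^sub>k\<close> label all the \<open>D\<^sub>i\<close>
  by comparing empirical means of \<open>f\<close>.

  To bound the gap from below, condition on the values of the samples: the labels are then independent,
  with bias \<open>r\<^sub>i = (P\<^sub>i - Q\<^sub>i) / (P\<^sub>i + Q\<^sub>i)\<close> at value \<open>i\<close>.  The expected sign of a walk of \<open>t\<close>
  steps with drift \<open>r\<close> is \<open>r\<close> times its expected number of visits to \<open>0\<close>, hence at least of order
  \<open>min 1 (\<bar>r\<bar> * sqrt t)\<close>.  Values expected to be hit often are treated by Chebyshev and Cauchy-Schwarz,
  rarely hit ones through the negatively correlated events that they are hit at all.  This gives a
  gap of order \<open>min \<epsilon> (min (\<epsilon>\<^sup>2 * sqrt (s / n)) (\<epsilon>\<^sup>2 * s / n))\<close>, whose three terms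
  correspond to the three regimes, while the conditional variance of the gap is \<open>O(1 / s)\<close>.
\<close>

subsection \<open>Sampling trees and finitely supported distributions\<close>

text \<open>Samples are requested in an order fixed beforehand. Off the list the collected function
  is \<open>0\<close>, matching the default of the \<open>Pi_pmf\<close> that will describe
  it.\<close>

primrec ask_all ::
  "'j list \<Rightarrow> ('j \<Rightarrow> 's) \<Rightarrow> (('j \<Rightarrow> nat) \<Rightarrow> ('s, 'o) qtree) \<Rightarrow> ('s, 'o) qtree" where
  "ask_all [] src c = c (\<lambda>_. 0)"
| "ask_all (j # js) src c = Ask (src j) (\<lambda>x. ask_all js src (\<lambda>\<omega>. c (fun_upd \<omega> j x)))"

text \<open>Distinct indices are never overwritten, so each request peels one independent factor off
  the product.\<close>

lemma run_ask_all:
  assumes "distinct js"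
  shows "run env (ask_all js src c) =
    bind_pmf (Pi_pmf (set js) 0 (\<lambda>j. env (src j))) (\<lambda>\<omega>. run env (c \<omega>))"
  using assms
proof (induction js arbitrary: c)
  case Nil
  then show ?case by (simp add: bind_return_pmf)
next
  case (Cons j js)
  then show ?case
    by (simp add: Pi_pmf_insert' bind_assoc_pmf bind_return_pmf)
qed

lemma within_samples_ask_all:
  assumes "\<And>\<omega>. within_samples (c \<omega>) (b - real (length js))" "real (length js) \<le> b"
  shows "within_samples (ask_all js src c) b"
  using assms by (induction js arbitrary: c b) (auto simp: algebra_simps)

text \<open>Off the good event \<open>G\<close> the inner probability is bounded by
  \<open>1\<close>, on it by \<open>b\<close>; integrating adds the two. This separates the failures
  of successive stages.\<close>

lemma prob_bind_pmf_le:
  assumes "measure_pmf.prob p {x. \<not> G x} \<le> a"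
    and "\<And>x. x \<in> set_pmf p \<Longrightarrow> G x \<Longrightarrow> measure_pmf.prob (q x) B \<le> b"
    and "0 \<le> b"
  shows "measure_pmf.prob (bind_pmf p q) B \<le> a + b"
proof -
  have "ennreal (measure_pmf.prob (bind_pmf p q) B) = (\<integral>\<^sup>+x. ennreal (measure_pmf.prob (q x) B) \<partial>p)"
    by (simp flip: measure_pmf.emeasure_eq_measure)
  also have "\<dots> \<le> (\<integral>\<^sup>+x. indicator {x. \<not> G x} x + ennreal b \<partial>p)"
    by (intro nn_integral_mono_AE)
       (auto simp: AE_measure_pmf_iff indicator_def ennreal_leI assms(2)
          intro: order_trans[of _ 1])
  also have "\<dots> = ennreal (measure_pmf.prob p {x. \<not> G x} + b)"
    using assms(3) by (subst nn_integral_add)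
      (auto simp: measure_pmf.emeasure_eq_measure)
  also have "\<dots> \<le> ennreal (a + b)"
    using assms(1) by (intro ennreal_leI) auto
  finally show ?thesis
    using assms(1,3) measure_nonneg[of p "{x. \<not> G x}"]
    by (subst (asm) ennreal_le_iff) linarith+
qed

text \<open>The chain rule for joint mass functions, by which two orders of sampling can be compared
  pointwise.\<close>

lemma pmf_bind_Pair:
  "pmf (bind_pmf p (\<lambda>x. map_pmf (Pair x) (q x))) (a, b) = pmf p a * pmf (q a) b"
proof -
  have "pmf (map_pmf (Pair x) (q x)) (a, b) = indicator {a} x * pmf (q x) b" for x
  proof (cases "x = a")
    case True
    then show ?thesis
      using pmf_map_inj'[of "Pair a" "q a" b] by (simp add: inj_on_def)
  next
    case False
    then show ?thesis
      by (auto simp: pmf_eq_0_set_pmf)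
  qed
  then have "pmf (bind_pmf p (\<lambda>x. map_pmf (Pair x) (q x))) (a, b) =
      measure_pmf.expectation p (\<lambda>x. indicator {a} x * pmf (q x) b)"
    by (simp add: pmf_bind)
  also have "\<dots> = pmf p a * pmf (q a) b"
    by (subst integral_measure_pmf_real[of "{a}"]) (auto split: split_indicator_asm)
  finally show ?thesis .
qed

section \<open>Expectations, tails and variances of finitely supported distributions\<close>

lemma expectation_sum_finite_pmf:
  fixes f :: "'i \<Rightarrow> 'a \<Rightarrow> real"
  assumes "finite (set_pmf p)"
  shows "measure_pmf.expectation p (\<lambda>x. \<Sum>i\<in>A. f i x) = (\<Sum>i\<in>A. measure_pmf.expectation p (f i))"
  by (rule Bochner_Integration.integral_sum) (rule integrable_measure_pmf_finite[OF assms])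

lemma expectation_mono_finite_pmf:
  fixes f :: "'a \<Rightarrow> real"
  assumes "finite (set_pmf p)" "\<And>x. x \<in> set_pmf p \<Longrightarrow> f x \<le> g x"
  shows "measure_pmf.expectation p f \<le> measure_pmf.expectation p g"
  by (intro integral_mono_AE integrable_measure_pmf_finite assms) (auto simp: AE_measure_pmf_iff assms)

lemma Markov_finite_pmf:
  fixes f :: "'a \<Rightarrow> real"
  assumes "finite (set_pmf p)" "\<And>x. x \<in> set_pmf p \<Longrightarrow> 0 \<le> f x" "0 < c"
  shows "measure_pmf.prob p {x. c \<le> f x} \<le> measure_pmf.expectation p f / c"
  using integral_Markov_inequality_measure[of "measure_pmf p" f UNIV c] assms
  by (auto simp: AE_measure_pmf_iff integrable_measure_pmf_finite)

lemma Chebyshev_lower_finite_pmf: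
  fixes f :: "'a \<Rightarrow> real"
  assumes "finite (set_pmf p)" "0 < c"
  shows "measure_pmf.prob p {x. f x \<le> measure_pmf.expectation p f - c} \<le>
    measure_pmf.variance p f / c\<^sup>2"
proof -
  have "measure_pmf.prob p {x. f x \<le> measure_pmf.expectation p f - c} \<le>
      measure_pmf.prob p {x. c \<le> \<bar>f x - measure_pmf.expectation p f\<bar>}"
    by (intro measure_pmf.finite_measure_mono) auto
  also have "\<dots> \<le> measure_pmf.variance p f / c\<^sup>2"
    using measure_pmf.Chebyshev_inequality[of f p c] assms
    by (simp add: integrable_measure_pmf_finite)
  finally show ?thesis .
qed

lemma finite_set_Pi_pmf:
  assumes "finite A" "\<And>x. x \<in> A \<Longrightarrow> finite (set_pmf (p x))"
  shows "finite (set_pmf (Pi_pmf A dflt p))"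
  using assms by (auto simp: set_Pi_pmf)

lemma expectation_pair_pmf_mult:
  fixes F :: "'a \<Rightarrow> real" and G :: "'b \<Rightarrow> real"
  assumes "finite (set_pmf p)" "finite (set_pmf q)"
  shows "measure_pmf.expectation (pair_pmf p q) (\<lambda>(x, y). F x * G y) =
    measure_pmf.expectation p F * measure_pmf.expectation q G"
proof -
  have "measure_pmf.expectation (pair_pmf p q) (\<lambda>(x, y). F x * G y) =
      (\<Sum>a\<in>set_pmf p \<times> set_pmf q. pmf (pair_pmf p q) a *\<^sub>R (case a of (x, y) \<Rightarrow> F x * G y))"
    by (rule integral_measure_pmf) (use assms in auto)
  also have "\<dots> = (\<Sum>x\<in>set_pmf p. \<Sum>y\<in>set_pmf q. (pmf p x * F x) * (pmf q y * G y))"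
    by (subst sum.cartesian_product) (auto intro!: sum.cong simp: pmf_pair)
  also have "\<dots> = (\<Sum>x\<in>set_pmf p. pmf p x * F x) * (\<Sum>y\<in>set_pmf q. pmf q y * G y)"
    by (simp add: sum_product)
  also have "\<dots> = measure_pmf.expectation p F * measure_pmf.expectation q G"
    by (subst (1 2) integral_measure_pmf) (use assms in auto)
  finally show ?thesis .
qed

text \<open>The product splits into independent factors over \<open>A\<close> and
  \<open>I - A\<close>; \<open>F\<close> reads only the first and \<open>G\<close>, as
  \<open>B\<close> lies in \<open>I - A\<close>, only the second.\<close>

lemma expectation_Pi_pmf_disjoint_blocks:
  fixes F G :: "('a \<Rightarrow> 'b) \<Rightarrow> real"
  assumes "finite I" "\<And>x. x \<in> I \<Longrightarrow> finite (set_pmf (p x))"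
    and "A \<subseteq> I" "B \<subseteq> I" "A \<inter> B = {}"
    and F: "\<And>f g. (\<And>x. x \<in> A \<Longrightarrow> f x = g x) \<Longrightarrow> F f = F g"
    and G: "\<And>f g. (\<And>x. x \<in> B \<Longrightarrow> f x = g x) \<Longrightarrow> G f = G g"
  shows "measure_pmf.expectation (Pi_pmf I dflt p) (\<lambda>f. F f * G f) =
    measure_pmf.expectation (Pi_pmf I dflt p) F * measure_pmf.expectation (Pi_pmf I dflt p) G"
proof -
  define p1 where "p1 = Pi_pmf A dflt p"
  define p2 where "p2 = Pi_pmf (I - A) dflt p"
  have fin: "finite (set_pmf p1)" "finite (set_pmf p2)"
    unfolding p1_def p2_def using assms(1-4) finite_subset[of A I]
    by (auto intro!: finite_set_Pi_pmf)
  have "Pi_pmf I dflt p = Pi_pmf (A \<union> (I - A)) dflt p"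
    using assms(3) by (intro arg_cong[of _ _ "\<lambda>S. Pi_pmf S dflt p"]) auto
  also have "\<dots> = map_pmf (\<lambda>(f, g) x. if x \<in> A then f x else g x) (pair_pmf p1 p2)"
    unfolding p1_def p2_def using assms(1,3) finite_subset[of A I] by (intro Pi_pmf_union) auto
  finally have eq: "Pi_pmf I dflt p =
    map_pmf (\<lambda>(f, g) x. if x \<in> A then f x else g x) (pair_pmf p1 p2)" .
  have FF: "F (\<lambda>x. if x \<in> A then f x else g x) = F f"
    and GG: "G (\<lambda>x. if x \<in> A then f x else g x) = G g" for f g
    using assms(4,5) by (auto intro!: F G)
  show ?thesis
    using expectation_pair_pmf_mult[OF fin, of F G]
    by (simp add: eq case_prod_unfold FF GG)
qed

text \<open>The centred square expands into covariances, and the off-diagonal ones are at most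
  \<open>0\<close>. It serves both for independent votes and for the negatively correlated events
  that values are hit.\<close>

lemma variance_sum_le_if_nonpos_correlated:
  fixes f :: "'i \<Rightarrow> 'a \<Rightarrow> real"
  assumes "finite (set_pmf p)" "finite A"
    and "\<And>i j. i \<in> A \<Longrightarrow> j \<in> A \<Longrightarrow> i \<noteq> j \<Longrightarrow>
      measure_pmf.expectation p (\<lambda>x. f i x * f j x) \<le>
      measure_pmf.expectation p (f i) * measure_pmf.expectation p (f j)"
  shows "measure_pmf.variance p (\<lambda>x. \<Sum>i\<in>A. f i x) \<le> (\<Sum>i\<in>A. measure_pmf.variance p (f i))"
proof -
  note int = integrable_measure_pmf_finite[OF assms(1)]
  let ?E = "measure_pmf.expectation p"
  define g where "g i x = f i x - ?E (f i)" for i x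
  have cov: "?E (\<lambda>x. g i x * g j x) = ?E (\<lambda>x. f i x * f j x) - ?E (f i) * ?E (f j)" for i j
  proof -
    have "?E (\<lambda>x. g i x * g j x) = ?E (\<lambda>x. f i x * f j x - ?E (f i) * f j x - ?E (f j) * f i x
      + ?E (f i) * ?E (f j))"
      by (intro Bochner_Integration.integral_cong) (auto simp: g_def algebra_simps)
    also have "\<dots> = ?E (\<lambda>x. f i x * f j x) - ?E (f i) * ?E (f j)"
      by (simp add: int)
    finally show ?thesis .
  qed
  have "measure_pmf.variance p (\<lambda>x. \<Sum>i\<in>A. f i x) = ?E (\<lambda>x. (\<Sum>i\<in>A. g i x)\<^sup>2)"
    by (simp add: g_def expectation_sum_finite_pmf[OF assms(1)] sum_subtractf)
  also have "\<dots> = (\<Sum>i\<in>A. \<Sum>j\<in>A. ?E (\<lambda>x. g i x * g j x))"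
    by (simp add: power2_eq_square sum_product expectation_sum_finite_pmf[OF assms(1)])
  also have "\<dots> \<le> (\<Sum>i\<in>A. \<Sum>j\<in>A. if i = j then ?E (\<lambda>x. g i x * g i x) else 0)"
    by (intro sum_mono) (auto simp: cov assms(3))
  also have "\<dots> = (\<Sum>i\<in>A. measure_pmf.variance p (f i))"
    using assms(2) by (simp add: g_def power2_eq_square)
  finally show ?thesis .
qed

section \<open>Moments and lower tail of the binomial distribution\<close>

lemma expectation_binomial_pmf_Suc:
  fixes \<phi> :: "nat \<Rightarrow> real"
  assumes "p \<in> {0..1}"
  shows "measure_pmf.expectation (binomial_pmf (Suc t) p) \<phi> =
    measure_pmf.expectation (binomial_pmf t p) (\<lambda>x. p * \<phi> (Suc x) + (1 - p) * \<phi> x)"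
proof -
  have [simp]: "finite (set_pmf (binomial_pmf t p))"
    using assms by (rule finite_set_pmf_binomial_pmf)
  have "measure_pmf.expectation (binomial_pmf (Suc t) p) \<phi> =
    measure_pmf.expectation (bind_pmf (bernoulli_pmf p)
      (\<lambda>b. map_pmf (\<lambda>k. (if b then 1 else 0) + k) (binomial_pmf t p))) \<phi>"
    using assms by (simp add: binomial_pmf_Suc map_pmf_def)
  also have "\<dots> = p * measure_pmf.expectation (binomial_pmf t p) (\<lambda>x. \<phi> (Suc x))
      + (1 - p) * measure_pmf.expectation (binomial_pmf t p) \<phi>"
    using assms by (subst pmf_expectation_bind[of UNIV]) (auto simp: UNIV_bool)
  also have "\<dots> = measure_pmf.expectation (binomial_pmf t p) (\<lambda>x. p * \<phi> (Suc x) + (1 - p) * \<phi> x)"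
    using assms by (simp add: integrable_measure_pmf_finite)
  finally show ?thesis .
qed

lemma binomial_pmf_second_moment:
  assumes "p \<in> {0..1}"
  shows "measure_pmf.expectation (binomial_pmf t p) (\<lambda>x. (real x - real t * p)\<^sup>2) = real t * p * (1 - p)"
proof (induction t)
  case 0
  then show ?case using assms by (simp add: binomial_pmf_0)
next
  case (Suc t)
  have [simp]: "finite (set_pmf (binomial_pmf t p))"
    using assms by (rule finite_set_pmf_binomial_pmf)
  \<comment> \<open>The new coin, once centred, has mean zero, so the cross term vanishes and only
    its variance is added.\<close>
  have "p * (real (Suc x) - real (Suc t) * p)\<^sup>2 + (1 - p) * (real x - real (Suc t) * p)\<^sup>2
      = (real x - real t * p)\<^sup>2 + p * (1 - p)" for x
    by (simp add: power2_eq_square algebra_simps)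
  then show ?case
    using assms Suc by (simp add: expectation_binomial_pmf_Suc integrable_measure_pmf_finite)
      (simp add: algebra_simps)
qed

text \<open>Chebyshev's inequality at distance half the mean, with the factor \<open>1 - p\<close>
  of the variance dropped.\<close>

lemma binomial_pmf_lower_tail:
  assumes "p \<in> {0..1}" "0 < real t * p"
  shows "measure_pmf.prob (binomial_pmf t p) {x. real x < real t * p / 2} \<le> 4 / (real t * p)"
proof -
  have "measure_pmf.prob (binomial_pmf t p) {x. real x < real t * p / 2} \<le>
      measure_pmf.prob (binomial_pmf t p) {x. (real t * p / 2)\<^sup>2 \<le> (real x - real t * p)\<^sup>2}"
    using assms(2)
    by (intro measure_pmf.finite_measure_mono) (auto simp: abs_le_square_iff[symmetric] mult.commute)
  also have "\<dots> \<le> real t * p * (1 - p) / (real t * p / 2)\<^sup>2"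
    using assms zero_less_power[of "real t * p / 2" 2]
    by (subst binomial_pmf_second_moment[symmetric])
      (auto intro!: Markov_finite_pmf finite_set_pmf_binomial_pmf)
  also have "\<dots> \<le> (real t * p) / (real t * p / 2)\<^sup>2"
    using assms by (intro divide_right_mono mult_left_le) auto
  also have "\<dots> = 4 / (real t * p)"
    using assms by (simp add: power2_eq_square)
  finally show ?thesis .
qed

text \<open>Absorbing \<open>1 / (k + 1)\<close> into the binomial coefficient turns the sum into
  the expansion of \<open>(p + (1 - p)) ^ Suc t\<close> without its zeroth term, divided by
  \<open>(real t + 1) * p\<close>.\<close>

lemma binomial_pmf_expectation_inverse_Suc:
  assumes "p \<in> {0<..1}"
  shows "measure_pmf.expectation (binomial_pmf t p) (\<lambda>x. 1 / (real x + 1)) \<le> 1 / ((real t + 1) * p)"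
proof -
  have p: "p \<in> {0..1}" using assms by auto
  have c: "real (t choose k) / (real k + 1) = real (Suc t choose Suc k) / (real t + 1)" for k
  proof -
    have "real (Suc t) * real (t choose k) = real (Suc t choose Suc k) * real (Suc k)"
      using Suc_times_binomial_eq[of t k] by (metis of_nat_mult)
    then show ?thesis
      by (simp add: frac_eq_eq algebra_simps del: binomial_Suc_Suc)
  qed
  have "measure_pmf.expectation (binomial_pmf t p) (\<lambda>x. 1 / (real x + 1)) =
      (\<Sum>k\<le>t. (real (t choose k) / (real k + 1)) * p ^ k * (1 - p) ^ (t - k))"
    using p by (simp add: expectation_binomial_pmf')
  also have "\<dots> = (\<Sum>k\<le>t. real (Suc t choose Suc k) * p ^ Suc k * (1 - p) ^ (Suc t - Suc k)) / ((real t + 1) * p)"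
    using assms unfolding c sum_divide_distrib
    by (intro sum.cong refl) (simp add: divide_simps mult_ac del: binomial_Suc_Suc)
  also have "\<dots> \<le> 1 / ((real t + 1) * p)"
  proof (rule divide_right_mono)
    have "(\<Sum>k\<le>t. real (Suc t choose Suc k) * p ^ Suc k * (1 - p) ^ (Suc t - Suc k)) \<le>
        (\<Sum>k\<le>Suc t. real (Suc t choose k) * p ^ k * (1 - p) ^ (Suc t - k))"
      using p by (subst sum.atMost_Suc_shift) (simp del: binomial_Suc_Suc)
    also have "\<dots> = (p + (1 - p)) ^ Suc t"
      by (subst binomial_ring) simp
    finally show "(\<Sum>k\<le>t. real (Suc t choose Suc k) * p ^ Suc k * (1 - p) ^ (Suc t - Suc k)) \<le> 1"
      by simp
  qed (use assms in auto)
  finally show ?thesis .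
qed

subsection \<open>The sign of a biased random walk\<close>

text \<open>The expected number of visits to \<open>0\<close> before time \<open>t\<close> of the \<open>\<plusminus>1\<close> walk with drift \<open>r\<close>.\<close>
definition zero_visits :: "nat \<Rightarrow> real \<Rightarrow> real" where
  "zero_visits t r =
    (\<Sum>l<t. if even l then real (l choose (l div 2)) * ((1 - r\<^sup>2) / 4) ^ (l div 2) else 0)"

text \<open>After \<open>t\<close> steps the walk is at \<open>2 * x - t\<close>. The next step
  changes the expected sign only from the positions \<open>-1\<close>, \<open>0\<close> and
  \<open>1\<close>: from \<open>0\<close> by the drift \<open>r\<close>, while the contributions of
  \<open>1\<close> and \<open>-1\<close> cancel. Summing over time counts the visits to
  \<open>0\<close>.\<close>

lemma expectation_sgn_binomial_pmf:
  assumes "\<bar>r\<bar> \<le> 1"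
  shows "measure_pmf.expectation (binomial_pmf t ((1 + r) / 2)) (\<lambda>x. sgn (2 * real x - real t)) =
    r * zero_visits t r"
proof (induction t)
  case 0
  have "(1 + r) / 2 \<in> {0..1}" using assms by auto
  then show ?case by (simp add: binomial_pmf_0 zero_visits_def)
next
  case (Suc t)
  define p where "p = (1 + r) / 2"
  have p: "p \<in> {0..1}" using assms by (auto simp: p_def)
  have [simp]: "finite (set_pmf (binomial_pmf t p))"
    using p by (rule finite_set_pmf_binomial_pmf)
  \<comment> \<open>\<open>h x\<close> is the expected change of the sign in the next step, given
    \<open>x\<close> steps up so far.\<close>
  define h where "h x = (if 2 * x = t then r else if 2 * x = t + 1 then - (1 - p)
    else if 2 * x + 1 = t then p else 0)" for x
  have h: "p * sgn (2 * real (Suc x) - real (Suc t)) + (1 - p) * sgn (2 * real x - real (Suc t))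
      = sgn (2 * real x - real t) + h x" for x
  proof -
    consider "2 * x = t" | "2 * x = t + 1" | "2 * x + 1 = t" | "2 * x > t + 1" | "2 * x + 1 < t"
      by linarith
    then show ?thesis
    proof cases
      case 4
      then have "2 * real x > real t + 1" by linarith
      with 4 show ?thesis by (simp add: h_def sgn_if)
    next
      case 5
      then have "2 * real x + 1 < real t" by linarith
      with 5 show ?thesis by (simp add: h_def sgn_if)
    next
      case 2
      then have "2 * real x = real t + 1" by linarith
      with 2 show ?thesis by (simp add: h_def sgn_if)
    next
      case 3
      then have "2 * real x + 1 = real t" by linarith
      with 3 show ?thesis by (auto simp add: h_def sgn_if)
    next
      case 1
      then have "2 * real x = real t" by linarith
      with 1 show ?thesis by (simp add: h_def sgn_if p_def field_simps)
    qed
  qed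
  have Eh: "measure_pmf.expectation (binomial_pmf t p) h =
    r * (if even t then real (t choose (t div 2)) * ((1 - r\<^sup>2) / 4) ^ (t div 2) else 0)"
  proof (cases "even t")
    case True
    then obtain u where u: "t = 2 * u" by blast
    have "measure_pmf.expectation (binomial_pmf t p) h = h u * pmf (binomial_pmf t p) u"
      by (subst integral_measure_pmf_real[of "{u}"]) (auto simp: h_def u split: if_splits, (presburger+)?)
    also have "\<dots> = r * (real (t choose u) * (p ^ u * (1 - p) ^ u))"
      using p by (simp add: h_def u)
    also have "p ^ u * (1 - p) ^ u = ((1 - r\<^sup>2) / 4) ^ u"
      unfolding power_mult_distrib[symmetric]
      by (intro arg_cong[of _ _ "\<lambda>x. x ^ u"]) (simp add: p_def power2_eq_square field_simps)
    finally show ?thesis using True by (simp add: u)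
  next
    case False
    then obtain u where u: "t = 2 * u + 1" using oddE by blast
    have "measure_pmf.expectation (binomial_pmf t p) h = (\<Sum>x\<in>{u, u + 1}. h x * pmf (binomial_pmf t p) x)"
      by (rule integral_measure_pmf_real) (auto simp: h_def u split: if_splits, (presburger+)?)
    also have "\<dots> = p * (real (t choose u) * p ^ u * (1 - p) ^ (u + 1))
        - (1 - p) * (real (t choose (u + 1)) * p ^ (u + 1) * (1 - p) ^ u)"
      using p by (simp add: h_def u del: binomial_Suc_Suc) (simp add: algebra_simps del: binomial_Suc_Suc)
    \<comment> \<open>The coefficients of the positions \<open>1\<close> and \<open>-1\<close> agree
      by symmetry and the powers of \<open>p\<close> and \<open>1 - p\<close> match, so the two
      terms cancel.\<close>
    also have "t choose u = t choose (u + 1)"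
      using binomial_symmetric[of u t] by (simp add: u)
    finally show ?thesis using False by simp
  qed
  have "measure_pmf.expectation (binomial_pmf (Suc t) p) (\<lambda>x. sgn (2 * real x - real (Suc t))) =
      measure_pmf.expectation (binomial_pmf t p) (\<lambda>x. sgn (2 * real x - real t) + h x)"
    unfolding expectation_binomial_pmf_Suc[OF p] h ..
  also have "\<dots> = r * zero_visits t r + measure_pmf.expectation (binomial_pmf t p) h"
    using Suc by (simp add: integrable_measure_pmf_finite p_def[symmetric])
  also have "\<dots> = r * zero_visits (Suc t) r"
    unfolding Eh by (simp add: zero_visits_def algebra_simps)
  finally show ?case by (simp add: p_def)
qed

text \<open>A sign differing from \<open>sgn r\<close> forces the binomial variable to deviate from
  its mean by at least \<open>t * \<bar>r\<bar> / 2\<close>, which its second moment makes unlikely.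
  The weight \<open>r\<^sup>2\<close> compensates for the loss of concentration at small
  drift.\<close>

lemma variance_sgn_binomial_pmf:
  assumes "\<bar>r\<bar> \<le> 1" "0 < t"
  shows "r\<^sup>2 * measure_pmf.variance (binomial_pmf t ((1 + r) / 2)) (\<lambda>x. sgn (2 * real x - real t))
    \<le> 4 / real t"
proof (cases "r = 0")
  case False
  define p where "p = (1 + r) / 2"
  have p: "p \<in> {0..1}" using assms by (auto simp: p_def)
  have fin: "finite (set_pmf (binomial_pmf t p))"
    using p by (rule finite_set_pmf_binomial_pmf)
  note int = integrable_measure_pmf_finite[OF fin]
  define f where "f x = sgn (2 * real x - real t)" for x
  let ?E = "measure_pmf.expectation (binomial_pmf t p)"
  \<comment> \<open>Chosen so that \<open>c * (real t * r / 2)\<^sup>2\<close> equals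
    \<open>4\<close>, the largest possible value of \<open>(f x - sgn r)\<^sup>2\<close>.\<close>
  define c where "c = 16 / (real t * r)\<^sup>2"
  have pw: "(f x - sgn r)\<^sup>2 \<le> c * (real x - real t * p)\<^sup>2" for x
  proof (cases "sgn (2 * real x - real t) = sgn r")
    case True
    then show ?thesis by (simp add: f_def c_def)
  next
    case neq: False
    have "\<bar>real t * r / 2\<bar> \<le> \<bar>real x - real t * p\<bar>"
    proof (cases "r > 0")
      case True
      then have "2 * real x \<le> real t" using neq by (auto simp: sgn_if split: if_splits)
      then show ?thesis using True by (simp add: p_def field_simps)
    next
      case r: False
      then have "2 * real x \<ge> real t" using neq False by (auto simp: sgn_if split: if_splits)
      moreover have "real t * r \<le> 0" using r by (simp add: mult_nonneg_nonpos)
      ultimately show ?thesis by (simp add: p_def field_simps)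
    qed
    then have "(real t * r / 2)\<^sup>2 \<le> (real x - real t * p)\<^sup>2"
      by (rule abs_le_square_iff[THEN iffD1])
    moreover have "0 < (real t * r)\<^sup>2" using False assms by simp
    ultimately have "4 \<le> c * (real x - real t * p)\<^sup>2"
      by (simp add: c_def field_simps)
    moreover have "(f x - sgn r)\<^sup>2 \<le> 2\<^sup>2"
      unfolding abs_le_square_iff[symmetric] by (auto simp: f_def sgn_if)
    ultimately show ?thesis by simp
  qed
  \<comment> \<open>The second moment about any point, here \<open>sgn r\<close>, is at least the
    variance.\<close>
  have "?E (\<lambda>x. (f x - ?E f)\<^sup>2) \<le> ?E (\<lambda>x. (f x - ?E f)\<^sup>2) + (?E f - sgn r)\<^sup>2" by simp
  also have "\<dots> = ?E (\<lambda>x. (f x - sgn r)\<^sup>2)"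
  proof -
    have "?E (\<lambda>x. (f x - sgn r)\<^sup>2) = ?E (\<lambda>x. (f x - ?E f)\<^sup>2 + (2 * (?E f - sgn r) * (f x - ?E f) + (?E f - sgn r)\<^sup>2))"
      by (intro Bochner_Integration.integral_cong) (auto simp: power2_eq_square algebra_simps)
    then show ?thesis by (simp add: int)
  qed
  also have "\<dots> \<le> ?E (\<lambda>x. c * (real x - real t * p)\<^sup>2)"
    by (rule expectation_mono_finite_pmf[OF fin pw])
  also have "\<dots> = c * (real t * p * (1 - p))"
    by (simp add: binomial_pmf_second_moment[OF p])
  also have "\<dots> \<le> c * (real t / 4)"
  proof (rule mult_left_mono)
    have "p * (1 - p) \<le> 1 / 4"
      using zero_le_power2[of r] by (simp add: p_def power2_eq_square field_simps)
    from mult_left_mono[OF this, of "real t"] show "real t * p * (1 - p) \<le> real t / 4"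
      by (simp add: mult.assoc)
  qed (simp add: c_def)
  finally have "r\<^sup>2 * ?E (\<lambda>x. (f x - ?E f)\<^sup>2) \<le> r\<^sup>2 * (c * (real t / 4))"
    by (intro mult_left_mono) auto
  also have "\<dots> = 4 / real t"
    using False assms by (simp add: c_def power2_eq_square field_simps)
  finally show ?thesis by (simp add: f_def[abs_def] p_def)
qed simp

text \<open>Induction on the squared inequality: successive central binomial coefficients have ratio
  \<open>2 * (2 * u + 1) / (u + 1)\<close>, and
  \<open>4 * u * (u + 1) \<le> (2 * u + 1)\<^sup>2\<close>.\<close>

lemma central_binomial_ge_sqrt:
  assumes "0 < u"
  shows "4 ^ u / (2 * sqrt (real u)) \<le> real (2 * u choose u)"
proof -
  have "(4 ^ u)\<^sup>2 \<le> (2 * sqrt (real u) * real (2 * u choose u))\<^sup>2"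
    using assms
  proof (induction u rule: nat_induct_non_zero)
    case 1
    then show ?case by (simp add: numeral_2_eq_2)
  next
    case (Suc u)
    have rec: "real (2 * Suc u choose Suc u) * (real u + 1) = real (2 * u choose u) * (2 * (2 * real u + 1))"
    proof -
      have "real (2 * Suc u choose Suc u) = (2 * real u + 2) * (2 * real u + 1) * fact (2 * u)
          / ((real u + 1) * fact u * ((real u + 1) * fact u))"
        using binomial_fact[of "Suc u" "2 * Suc u", where 'a = real] by (simp add: algebra_simps)
      moreover have "real (2 * u choose u) = fact (2 * u) / (fact u * fact u)"
        using binomial_fact[of u "2 * u", where 'a = real] by simp
      moreover have "(2 * x + 2) * (2 * x + 1) * F / ((x + 1) * f * ((x + 1) * f)) * (x + 1) =
          F / (f * f) * (2 * (2 * x + 1))" if "f \<noteq> 0" "x + 1 \<noteq> 0" for x F f :: real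
        using that by (simp add: divide_simps) (simp add: algebra_simps)
      ultimately show ?thesis by simp
    qed
    have "(4 ^ Suc u)\<^sup>2 * (real u + 1)\<^sup>2 = 16 * (real u + 1)\<^sup>2 * (4 ^ u)\<^sup>2"
      by (simp add: power_mult_distrib)
    also have "\<dots> \<le> 16 * (real u + 1)\<^sup>2 * (2 * sqrt (real u) * real (2 * u choose u))\<^sup>2"
      using Suc by (intro mult_left_mono) auto
    also have "\<dots> = 16 * (real u + 1) * (real (2 * u choose u))\<^sup>2 * (4 * real u * (real u + 1))"
      by (simp add: power_mult_distrib power2_eq_square[of "real u + 1"])
    also have "\<dots> \<le> 16 * (real u + 1) * (real (2 * u choose u))\<^sup>2 * (2 * real u + 1)\<^sup>2"
      by (intro mult_left_mono) (auto simp: power2_eq_square algebra_simps)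
    also have "\<dots> = 4 * (real u + 1) * (real (2 * u choose u) * (2 * (2 * real u + 1)))\<^sup>2"
      by (simp add: power2_eq_square algebra_simps)
    also have "\<dots> = (2 * sqrt (real (Suc u)) * real (2 * Suc u choose Suc u))\<^sup>2 * (real u + 1)\<^sup>2"
      unfolding rec[symmetric] by (simp add: power_mult_distrib del: mult_Suc_right binomial_Suc_Suc)
    finally show ?case by (rule mult_right_le_imp_le) simp
  qed
  then have "4 ^ u \<le> 2 * sqrt (real u) * real (2 * u choose u)"
    by (rule power2_le_imp_le) simp
  then show ?thesis using assms by (simp add: field_simps)
qed

lemma zero_visits_ge_1:
  assumes "\<bar>r\<bar> \<le> 1" "0 < t"
  shows "1 \<le> zero_visits t r"
proof -
  have "r\<^sup>2 \<le> 1" using assms by (simp add: abs_square_le_1)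
  then have "(\<Sum>l\<in>{0}. if even l then real (l choose (l div 2)) * ((1 - r\<^sup>2) / 4) ^ (l div 2) else 0)
      \<le> zero_visits t r"
    unfolding zero_visits_def using assms by (intro sum_mono2) auto
  then show ?thesis by simp
qed

lemma zero_visits_nonneg:
  assumes "\<bar>r\<bar> \<le> 1"
  shows "0 \<le> zero_visits t r"
  unfolding zero_visits_def using assms by (intro sum_nonneg) (auto simp: abs_square_le_1)

text \<open>Each of the first \<open>N\<close> even times contributes at least
  \<open>1 / (4 * sqrt N)\<close>: the central binomial bound gives \<open>1 / (2 * sqrt N)\<close>,
  and by Bernoulli's inequality the drift costs at most a factor \<open>1 / 2\<close>.\<close>

lemma zero_visits_ge_sqrt:
  assumes "\<bar>r\<bar> \<le> 1" "1 \<le> N" "2 * N \<le> t + 1" "(real N - 1) * r\<^sup>2 \<le> 1 / 2"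
  shows "sqrt (real N) / 4 \<le> zero_visits t r"
proof -
  define F where "F l = (if even l then real (l choose (l div 2)) * ((1 - r\<^sup>2) / 4) ^ (l div 2) else 0)"
    for l
  have r2: "r\<^sup>2 \<le> 1" using assms by (simp add: abs_square_le_1)
  have F: "1 / (4 * sqrt (real N)) \<le> F (2 * u)" if "u < N" for u
  proof -
    have c: "1 / (2 * sqrt (real N)) \<le> real (2 * u choose u) / 4 ^ u"
    proof (cases "u = 0")
      case False
      have "1 / (2 * sqrt (real N)) \<le> 1 / (2 * sqrt (real u))"
        using that False by (intro divide_left_mono) auto
      also have "\<dots> \<le> real (2 * u choose u) / 4 ^ u"
        using central_binomial_ge_sqrt[of u] False by (simp add: field_simps)
      finally show ?thesis .
    next
      case True
      have "1 \<le> 2 * sqrt (real N)"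
        using real_sqrt_ge_one[of "real N"] assms(2) by linarith
      then show ?thesis using True assms(2) by (simp add: divide_le_eq_1)
    qed
    have "real u * r\<^sup>2 \<le> (real N - 1) * r\<^sup>2"
      using that by (intro mult_right_mono) auto
    then have "1 / 2 \<le> 1 + real u * (- r\<^sup>2)" using assms(4) by simp
    also have "\<dots> \<le> (1 + (- r\<^sup>2)) ^ u" by (rule Bernoulli_inequality) (use r2 in simp)
    finally have b: "1 / 2 \<le> (1 - r\<^sup>2) ^ u" by simp
    have "1 / (2 * sqrt (real N)) * (1 / 2) \<le> real (2 * u choose u) / 4 ^ u * (1 - r\<^sup>2) ^ u"
      using c b by (intro mult_mono) auto
    then show ?thesis by (simp add: F_def power_divide)
  qed
  have "sqrt (real N) / 4 = real N * (1 / (4 * sqrt (real N)))"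
    using assms(2) by (simp add: real_div_sqrt field_simps)
  also have "\<dots> \<le> (\<Sum>u<N. F (2 * u))"
    using sum_mono[of "{..<N}" "\<lambda>_. 1 / (4 * sqrt (real N))" "\<lambda>u. F (2 * u)"] F by simp
  also have "\<dots> = sum F ((\<lambda>u. 2 * u) ` {..<N})"
    by (subst sum.reindex) (auto simp: inj_on_def)
  also have "\<dots> \<le> sum F {..<t}"
    using assms(3) r2 by (intro sum_mono2) (auto simp: F_def)
  finally show ?thesis by (simp add: zero_visits_def F_def)
qed

text \<open>Up to time of order \<open>1 / r\<^sup>2\<close> the walk returns to \<open>0\<close>
  like a driftless one, so the visits grow as the square root of time until that horizon or
  \<open>t\<close> is reached.\<close>

lemma zero_visits_ge_min:
  assumes "\<bar>r\<bar> \<le> 1" "r \<noteq> 0" "0 < t"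
  shows "min (sqrt (real t)) (1 / \<bar>r\<bar>) / 6 \<le> zero_visits t r"
proof -
  define y where "y = min (sqrt (real t)) (1 / \<bar>r\<bar>)"
  \<comment> \<open>\<open>N\<close> is the number of even times used: \<open>(t + 1) div 2\<close>
    of them lie below \<open>t\<close>, and \<open>z + 1\<close> is the most that the drift
    condition of \<open>zero_visits_ge_sqrt\<close> permits.\<close>
  define z where "z = nat \<lfloor>1 / (2 * r\<^sup>2)\<rfloor>"
  define N where "N = min ((t + 1) div 2) (z + 1)"
  have r2: "0 < r\<^sup>2" using assms by simp
  have z: "real z \<le> 1 / (2 * r\<^sup>2)" "1 / (2 * r\<^sup>2) \<le> real z + 1"
    using r2 unfolding z_def by (auto simp: of_nat_nat)
  have "(real N - 1) * r\<^sup>2 \<le> real z * r\<^sup>2"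
    using r2 by (intro mult_right_mono) (auto simp: N_def)
  also have "\<dots> \<le> 1 / 2" using z(1) r2 by (simp add: field_simps)
  finally have "(real N - 1) * r\<^sup>2 \<le> 1 / 2" .
  moreover have "N \<le> (t + 1) div 2" "1 \<le> N" using assms(3) by (auto simp: N_def)
  then have "2 * N \<le> t + 1" "1 \<le> N" by linarith+
  ultimately have "sqrt (real N) / 4 \<le> zero_visits t r"
    using assms(1) by (intro zero_visits_ge_sqrt)
  moreover have "y / 6 \<le> sqrt (real N) / 4"
  proof -
    have "y\<^sup>2 \<le> real t"
      using power_mono[of y "sqrt (real t)" 2] by (simp add: y_def)
    moreover have "y\<^sup>2 \<le> 1 / r\<^sup>2"
      using power_mono[of y "1 / \<bar>r\<bar>" 2] by (simp add: y_def power_divide)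
    then have "y\<^sup>2 \<le> 2 * (real z + 1)" using z(2) by simp
    moreover have "real t \<le> 2 * real ((t + 1) div 2)" by linarith
    ultimately have "y\<^sup>2 \<le> 2 * real N" by (simp add: N_def min_def)
    \<comment> \<open>Rounding \<open>2\<close> up to the square \<open>9 / 4\<close> yields the
      constant \<open>6 = 4 * (3 / 2)\<close>.\<close>
    also have "\<dots> \<le> (3 / 2 * sqrt (real N))\<^sup>2" by (simp add: power_mult_distrib power_divide)
    finally have "y \<le> 3 / 2 * sqrt (real N)" by (rule power2_le_imp_le) simp
    then show ?thesis by simp
  qed
  ultimately show ?thesis by (simp add: y_def)
qed

subsection \<open>Majority votes of labelled samples\<close>

text \<open>The argument of \<open>sgn\<close> is the end point of a walk that steps up on each
  label \<open>True\<close> at \<open>i\<close> and down on each label \<open>False\<close>.\<close>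

definition vote :: "nat \<Rightarrow> (nat \<Rightarrow> bool) \<Rightarrow> (nat \<Rightarrow> nat) \<Rightarrow> nat \<Rightarrow> real" where
  "vote s b v i =
    sgn (2 * real (card {j \<in> {..<s}. v j = i \<and> b j}) - real (card {j \<in> {..<s}. v j = i}))"

lemma vote_cong:
  assumes "\<And>j. j < s \<Longrightarrow> v j = i \<Longrightarrow> b j = b' j"
  shows "vote s b v i = vote s b' v i"
proof -
  have "{j \<in> {..<s}. v j = i \<and> b j} = {j \<in> {..<s}. v j = i \<and> b' j}"
    using assms by auto
  then show ?thesis by (simp only: vote_def)
qed

locale training =
  fixes n s :: nat and P Q :: "nat pmf"
  assumes supp_P: "set_pmf P \<subseteq> {1..n}" and supp_Q: "set_pmf Q \<subseteq> {1..n}"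
begin

definition d :: "nat \<Rightarrow> real" where "d i = pmf P i - pmf Q i"
definition sg :: "nat \<Rightarrow> real" where "sg i = pmf P i + pmf Q i"
text \<open>Where both masses vanish, division by zero makes this \<open>0\<close>, so
  \<open>(1 + bias i) / 2\<close> is always a probability.\<close>

definition bias :: "nat \<Rightarrow> real" where "bias i = d i / sg i"
definition hits :: "(nat \<Rightarrow> nat) \<Rightarrow> nat \<Rightarrow> nat" where "hits v i = card {j \<in> {..<s}. v j = i}"
definition mix :: "nat pmf" where
  "mix = bind_pmf (bernoulli_pmf (1 / 2)) (\<lambda>b. if b then P else Q)"
definition vals :: "(nat \<Rightarrow> nat) pmf" where "vals = Pi_pmf {..<s} 0 (\<lambda>_. mix)"
text \<open>The conditional law of the labels given the values: where \<open>sg i\<close> is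
  positive, \<open>(1 + bias i) / 2\<close> is \<open>pmf P i / sg i\<close>, the posterior
  probability that a sample of value \<open>i\<close> came from \<open>P\<close>.\<close>

definition labels :: "(nat \<Rightarrow> nat) \<Rightarrow> (nat \<Rightarrow> bool) pmf" where
  "labels v = Pi_pmf {..<s} False (\<lambda>j. bernoulli_pmf ((1 + bias (v j)) / 2))"
definition gap :: "(nat \<Rightarrow> bool) \<Rightarrow> (nat \<Rightarrow> nat) \<Rightarrow> real" where
  "gap b v = (\<Sum>i\<in>{1..n}. d i * vote s b v i)"
definition mean_gap :: "(nat \<Rightarrow> nat) \<Rightarrow> real" where
  "mean_gap v = (\<Sum>i\<in>{1..n}. d i * bias i * zero_visits (hits v i) (bias i))"

lemma sg_nonneg: "0 \<le> sg i"
  by (simp add: sg_def)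

lemma abs_d_le_sg: "\<bar>d i\<bar> \<le> sg i"
  unfolding d_def sg_def using pmf_nonneg[of P i] pmf_nonneg[of Q i] by linarith

lemma d_eq_0: "sg i = 0 \<Longrightarrow> d i = 0"
  using abs_d_le_sg[of i] by simp

lemma abs_bias_le_1: "\<bar>bias i\<bar> \<le> 1"
  using abs_d_le_sg[of i] by (cases "sg i = 0") (auto simp: bias_def divide_le_eq_1)

lemma bias_prob: "(1 + bias i) / 2 \<in> {0..1}"
  using abs_bias_le_1[of i] by auto

lemma d_bias_nonneg: "0 \<le> d i * bias i"
  using sg_nonneg[of i] by (simp add: bias_def)

lemma pmf_mix: "pmf mix i = sg i / 2"
  by (simp add: mix_def pmf_bind sg_def)

lemma sg_half_prob: "sg i / 2 \<in> {0..1}"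
  using pmf_le_1[of mix i] pmf_nonneg[of mix i] unfolding pmf_mix by simp

lemma sum_sg: "(\<Sum>i\<in>{1..n}. sg i) = 2"
  using sum_pmf_eq_1[OF _ supp_P] sum_pmf_eq_1[OF _ supp_Q] by (simp add: sg_def sum.distrib)

lemma finite_set_mix: "finite (set_pmf mix)"
  unfolding mix_def using supp_P supp_Q by (auto intro: finite_subset)

lemma finite_set_vals: "finite (set_pmf vals)"
  unfolding vals_def by (intro finite_set_Pi_pmf finite_set_mix) auto

lemma finite_set_labels: "finite (set_pmf (labels v))"
  unfolding labels_def by (intro finite_set_Pi_pmf) auto

text \<open>Bayes' rule, sample by sample: a fair label followed by a value has the same joint law
  as a value from the mixture followed by a label from the posterior. The algorithm uses the first
  order, the analysis the second.\<close>

lemma labelled_samples_eq: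
  "bind_pmf (Pi_pmf {..<s} False (\<lambda>_. bernoulli_pmf (1 / 2)))
      (\<lambda>b. map_pmf (Pair b) (Pi_pmf {..<s} 0 (\<lambda>j. if b j then P else Q))) =
    map_pmf prod.swap (bind_pmf vals (\<lambda>v. map_pmf (Pair v) (labels v)))"
    (is "?L = map_pmf _ ?R")
proof (rule pmf_eqI)
  fix bv :: "(nat \<Rightarrow> bool) \<times> (nat \<Rightarrow> nat)"
  obtain b v where bv: "bv = (b, v)" by (cases bv)
  have swap: "pmf (map_pmf prod.swap ?R) (b, v) = pmf ?R (v, b)"
    using pmf_map_inj'[of prod.swap ?R "(v, b)"] by simp
  have *: "(1 / 2) * pmf (if b j then P else Q) (v j) =
      pmf mix (v j) * pmf (bernoulli_pmf ((1 + bias (v j)) / 2)) (b j)" for j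
  proof (cases "sg (v j) = 0")
    case True
    then have "pmf P (v j) = 0" "pmf Q (v j) = 0"
      using pmf_nonneg[of P "v j"] pmf_nonneg[of Q "v j"] unfolding sg_def by linarith+
    then show ?thesis using True by (simp add: pmf_mix)
  next
    case False
    then have sd: "sg (v j) * bias (v j) = d (v j)" by (simp add: bias_def)
    show ?thesis
    proof (cases "b j")
      case True
      have "pmf mix (v j) * pmf (bernoulli_pmf ((1 + bias (v j)) / 2)) (b j) = (sg (v j) + sg (v j) * bias (v j)) / 4"
        using bias_prob[of "v j"] True by (simp add: pmf_mix algebra_simps)
      then show ?thesis using True unfolding sd by (simp add: sg_def d_def)
    next
      case nb: False
      have "pmf mix (v j) * pmf (bernoulli_pmf ((1 + bias (v j)) / 2)) (b j) = (sg (v j) - sg (v j) * bias (v j)) / 4"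
        using bias_prob[of "v j"] nb by (simp add: pmf_mix algebra_simps)
      then show ?thesis using nb unfolding sd by (simp add: sg_def d_def)
    qed
  qed
  \<comment> \<open>The conditionals are the default-value conditions of \<open>pmf_Pi\<close>,
    which appear in opposite order on the two sides.\<close>
  have ifs: "(if A then w else 0) * (if B then x else 0) = (if B then y else 0) * (if A then z else 0)"
    if "w * x = y * z" for A B and w x y z :: real
    using that by simp
  show "pmf ?L bv = pmf (map_pmf prod.swap ?R) bv"
    unfolding bv swap
    unfolding pmf_bind_Pair
    unfolding vals_def labels_def pmf_Pi[OF finite_lessThan]
  proof (rule ifs)
    show "(\<Prod>j<s. pmf (bernoulli_pmf (1 / 2)) (b j)) * (\<Prod>j<s. pmf (if b j then P else Q) (v j)) =
        (\<Prod>j<s. pmf mix (v j)) * (\<Prod>j<s. pmf (bernoulli_pmf ((1 + bias (v j)) / 2)) (b j))"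
      unfolding prod.distrib[symmetric] pmf_bernoulli_half by (intro prod.cong refl *)
  qed
qed

text \<open>The labels at the positions of value \<open>i\<close> are independent coins of equal
  bias; the other coordinates are projected away.\<close>

lemma positive_labels_binomial:
  "map_pmf (\<lambda>b. card {j \<in> {..<s}. v j = i \<and> b j}) (labels v) =
    binomial_pmf (hits v i) ((1 + bias i) / 2)"
proof -
  define J where "J = {j \<in> {..<s}. v j = i}"
  have "binomial_pmf (hits v i) ((1 + bias i) / 2) =
      map_pmf (\<lambda>f. card {x \<in> J. f x}) (Pi_pmf J False (\<lambda>_. bernoulli_pmf ((1 + bias i) / 2)))"
    by (rule binomial_pmf_altdef'[OF _ _ bias_prob]) (auto simp: J_def hits_def)
  also have "Pi_pmf J False (\<lambda>_. bernoulli_pmf ((1 + bias i) / 2)) =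
      Pi_pmf J False (\<lambda>j. bernoulli_pmf ((1 + bias (v j)) / 2))"
    by (intro Pi_pmf_cong) (auto simp: J_def)
  also have "\<dots> = map_pmf (\<lambda>f x. if x \<in> J then f x else False) (labels v)"
    unfolding labels_def by (rule Pi_pmf_subset) (auto simp: J_def)
  finally show ?thesis
    by (simp add: map_pmf_comp J_def conj_commute conj_left_commute cong: conj_cong)
qed

lemma expectation_labels_eq_binomial:
  fixes \<phi> :: "nat \<Rightarrow> real"
  shows "measure_pmf.expectation (labels v) (\<lambda>b. \<phi> (card {j \<in> {..<s}. v j = i \<and> b j})) =
    measure_pmf.expectation (binomial_pmf (hits v i) ((1 + bias i) / 2)) \<phi>"
  unfolding positive_labels_binomial[symmetric] by simp

lemma expectation_vote:
  "measure_pmf.expectation (labels v) (\<lambda>b. vote s b v i) = bias i * zero_visits (hits v i) (bias i)"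
  using expectation_labels_eq_binomial[of v "\<lambda>x. sgn (2 * real x - real (hits v i))" i]
  by (simp add: vote_def hits_def expectation_sgn_binomial_pmf[OF abs_bias_le_1])

text \<open>Writing \<open>d i\<close> as \<open>sg i * bias i\<close> supplies the weight
  \<open>(bias i)\<^sup>2\<close> under which the variance of the sign is controlled. The
  denominator \<open>hits v i + 1\<close> also covers unhit values and has a simple expected
  inverse.\<close>

lemma variance_vote:
  "measure_pmf.variance (labels v) (\<lambda>b. d i * vote s b v i) \<le> 8 * (sg i)\<^sup>2 / (real (hits v i) + 1)"
proof -
  define V where "V = measure_pmf.variance (labels v) (\<lambda>b. vote s b v i)"
  have "measure_pmf.variance (labels v) (\<lambda>b. d i * vote s b v i) = (d i)\<^sup>2 * V"
    by (simp add: V_def power_mult_distrib right_diff_distrib[symmetric])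
  also have "\<dots> \<le> 8 * (sg i)\<^sup>2 / (real (hits v i) + 1)"
  proof (cases "hits v i = 0")
    case True
    then have "{j \<in> {..<s}. v j = i} = {}" by (simp add: hits_def)
    then have "vote s b v i = 0" for b
      unfolding vote_def by (subst card_eq_0_iff[THEN iffD2], blast, simp)+
    then have "V = 0" by (simp add: V_def)
    then show ?thesis by simp
  next
    case False
    define g where "g x = sgn (2 * real x - real (hits v i))" for x
    have "vote s b v i = g (card {j \<in> {..<s}. v j = i \<and> b j})" for b
      by (simp add: vote_def g_def hits_def)
    then have "V = measure_pmf.variance (labels v) (\<lambda>b. g (card {j \<in> {..<s}. v j = i \<and> b j}))"
      by (simp only: V_def)
    also have "\<dots> = measure_pmf.variance (binomial_pmf (hits v i) ((1 + bias i) / 2)) g"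
      unfolding expectation_labels_eq_binomial[of v g i]
      by (rule expectation_labels_eq_binomial[of v "\<lambda>x. (g x - c)\<^sup>2" i for c])
    finally have "V = measure_pmf.variance (binomial_pmf (hits v i) ((1 + bias i) / 2)) g" .
    with variance_sgn_binomial_pmf[OF abs_bias_le_1, of "hits v i" i] False
    have V: "(bias i)\<^sup>2 * V \<le> 4 / real (hits v i)" by (simp add: g_def[abs_def])
    have "(d i)\<^sup>2 * V = (sg i)\<^sup>2 * ((bias i)\<^sup>2 * V)"
      using d_eq_0[of i] by (cases "sg i = 0") (auto simp: bias_def power_divide)
    also have "\<dots> \<le> (sg i)\<^sup>2 * (4 / real (hits v i))"
      using V by (rule mult_left_mono) simp
    also have "4 / real (hits v i) \<le> 8 / (real (hits v i) + 1)"
      using False by (simp add: field_simps)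
    then have "(sg i)\<^sup>2 * (4 / real (hits v i)) \<le> (sg i)\<^sup>2 * (8 / (real (hits v i) + 1))"
      by (rule mult_left_mono) simp
    finally show ?thesis by (simp add: mult.commute)
  qed
  finally show ?thesis .
qed

lemma expectation_gap: "measure_pmf.expectation (labels v) (\<lambda>b. gap b v) = mean_gap v"
  unfolding gap_def mean_gap_def
  by (simp add: expectation_sum_finite_pmf[OF finite_set_labels] expectation_vote mult.assoc)

text \<open>Votes at different values read disjoint sets of labels, hence are independent given the
  values.\<close>

lemma variance_gap:
  "measure_pmf.variance (labels v) (\<lambda>b. gap b v) \<le> (\<Sum>i\<in>{1..n}. 8 * (sg i)\<^sup>2 / (real (hits v i) + 1))"
proof -
  have "measure_pmf.variance (labels v) (\<lambda>b. gap b v) \<le>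
      (\<Sum>i\<in>{1..n}. measure_pmf.variance (labels v) (\<lambda>b. d i * vote s b v i))"
    unfolding gap_def
  proof (rule variance_sum_le_if_nonpos_correlated[OF finite_set_labels])
    fix i l :: nat assume "i \<noteq> l"
    show "measure_pmf.expectation (labels v) (\<lambda>b. d i * vote s b v i * (d l * vote s b v l)) \<le>
      measure_pmf.expectation (labels v) (\<lambda>b. d i * vote s b v i) *
      measure_pmf.expectation (labels v) (\<lambda>b. d l * vote s b v l)"
      unfolding labels_def
    proof (rule eq_refl, rule expectation_Pi_pmf_disjoint_blocks
        [where A = "{j \<in> {..<s}. v j = i}" and B = "{j \<in> {..<s}. v j = l}"])
      have *: "d m * vote s f v m = d m * vote s g v m"
        if "\<And>x. x \<in> {j \<in> {..<s}. v j = m} \<Longrightarrow> f x = g x" for m f g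
        by (intro arg_cong[of _ _ "\<lambda>x. d m * x"] vote_cong that) simp
      show "d i * vote s f v i = d i * vote s g v i"
        if "\<And>x. x \<in> {j \<in> {..<s}. v j = i} \<Longrightarrow> f x = g x" for f g using that by (rule *)
      show "d l * vote s f v l = d l * vote s g v l"
        if "\<And>x. x \<in> {j \<in> {..<s}. v j = l} \<Longrightarrow> f x = g x" for f g using that by (rule *)
    qed (use \<open>i \<noteq> l\<close> in auto)
  qed simp
  also have "\<dots> \<le> (\<Sum>i\<in>{1..n}. 8 * (sg i)\<^sup>2 / (real (hits v i) + 1))"
    by (intro sum_mono variance_vote)
  finally show ?thesis .
qed

text \<open>Hitting \<open>i\<close> is a Bernoulli trial per sample. Positivity of \<open>i\<close>
  sends the default value \<open>0\<close> of \<open>vals\<close> to the default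
  \<open>False\<close>.\<close>

lemma hits_binomial:
  assumes "0 < i"
  shows "map_pmf (\<lambda>v. hits v i) vals = binomial_pmf s (sg i / 2)"
proof -
  have b: "map_pmf (\<lambda>x. x = i) mix = bernoulli_pmf (sg i / 2)"
  proof (rule pmf_eqI)
    fix c :: bool
    have t: "pmf (map_pmf (\<lambda>x. x = i) mix) True = sg i / 2"
      by (simp add: pmf_map vimage_def measure_pmf_single pmf_mix)
    moreover have "pmf (map_pmf (\<lambda>x. x = i) mix) False = 1 - pmf (map_pmf (\<lambda>x. x = i) mix) True"
      using pmf_False_conv_True by blast
    ultimately show "pmf (map_pmf (\<lambda>x. x = i) mix) c = pmf (bernoulli_pmf (sg i / 2)) c"
      using sg_half_prob[of i] by (cases c) simp_all
  qed
  have "binomial_pmf s (sg i / 2) =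
      map_pmf (\<lambda>f. card {x \<in> {..<s}. f x}) (Pi_pmf {..<s} False (\<lambda>_. map_pmf (\<lambda>x. x = i) mix))"
    unfolding b by (rule binomial_pmf_altdef'[OF _ _ sg_half_prob]) auto
  also have "Pi_pmf {..<s} False (\<lambda>_. map_pmf (\<lambda>x. x = i) mix) = map_pmf (\<lambda>h. (\<lambda>x. x = i) \<circ> h) vals"
    unfolding vals_def using assms by (intro Pi_pmf_map) auto
  finally show ?thesis
    by (simp add: map_pmf_comp hits_def)
qed

text \<open>The expected inverse of \<open>hits v i + 1\<close> cancels one of the two factors
  \<open>sg i\<close>, and the masses \<open>sg i\<close> sum to \<open>2\<close>; hence
  \<open>8 * 2 * 2 = 32\<close>.\<close>

lemma expectation_variance_bound:
  "measure_pmf.expectation vals (\<lambda>v. \<Sum>i\<in>{1..n}. 8 * (sg i)\<^sup>2 / (real (hits v i) + 1)) \<le> 32 / (real s + 1)"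
proof -
  have "measure_pmf.expectation vals (\<lambda>v. 8 * (sg i)\<^sup>2 / (real (hits v i) + 1)) \<le> 16 * sg i / (real s + 1)"
    if "i \<in> {1..n}" for i
  proof (cases "sg i = 0")
    case False
    then have pos: "0 < sg i" using sg_nonneg[of i] by linarith
    have "measure_pmf.expectation vals (\<lambda>v. 8 * (sg i)\<^sup>2 / (real (hits v i) + 1)) =
        8 * (sg i)\<^sup>2 * measure_pmf.expectation (binomial_pmf s (sg i / 2)) (\<lambda>x. 1 / (real x + 1))"
      using that by (subst hits_binomial[symmetric]) (auto simp flip: integral_mult_right_zero)
    also have "\<dots> \<le> 8 * (sg i)\<^sup>2 * (1 / ((real s + 1) * (sg i / 2)))"
      using sg_half_prob[of i] pos
      by (intro mult_left_mono binomial_pmf_expectation_inverse_Suc) auto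
    also have "\<dots> = 16 * sg i / (real s + 1)"
      using pos by (simp add: power2_eq_square divide_simps)
    finally show ?thesis .
  qed simp
  then have "measure_pmf.expectation vals (\<lambda>v. \<Sum>i\<in>{1..n}. 8 * (sg i)\<^sup>2 / (real (hits v i) + 1)) \<le>
      (\<Sum>i\<in>{1..n}. 16 * sg i / (real s + 1))"
    unfolding expectation_sum_finite_pmf[OF finite_set_vals] by (rule sum_mono)
  also have "\<dots> = 32 / (real s + 1)"
    unfolding sum_divide_distrib[symmetric] sum_distrib_left[symmetric] sum_sg by simp
  finally show ?thesis .
qed

end

subsection \<open>Lower bounds on the conditional mean of the gap\<close>

lemma Cauchy_Schwarz_Engel:
  fixes x y :: "'i \<Rightarrow> real"
  assumes "\<And>i. i \<in> S \<Longrightarrow> 0 < y i"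
  shows "(\<Sum>i\<in>S. x i)\<^sup>2 \<le> (\<Sum>i\<in>S. (x i)\<^sup>2 / y i) * (\<Sum>i\<in>S. y i)"
proof -
  have "(\<Sum>i\<in>S. x i) = (\<Sum>i\<in>S. x i / sqrt (y i) * sqrt (y i))"
    using assms by (intro sum.cong) (auto simp: less_imp_neq[symmetric])
  also have "(\<dots>)\<^sup>2 \<le> (\<Sum>i\<in>S. (x i / sqrt (y i))\<^sup>2) * (\<Sum>i\<in>S. (sqrt (y i))\<^sup>2)"
    by (rule Cauchy_Schwarz_ineq_sum)
  also have "\<dots> = (\<Sum>i\<in>S. (x i)\<^sup>2 / y i) * (\<Sum>i\<in>S. y i)"
    using assms by (intro arg_cong2[of _ _ _ _ "(*)"] sum.cong)
      (auto simp: power_divide less_imp_le)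
  finally show ?thesis .
qed

lemma sum_sqrt_le:
  assumes "finite S" "\<And>i. i \<in> S \<Longrightarrow> 0 \<le> y i"
  shows "(\<Sum>i\<in>S. sqrt (y i)) \<le> sqrt (real (card S) * (\<Sum>i\<in>S. y i))"
proof (rule real_le_rsqrt)
  have "(\<Sum>i\<in>S. 1 * sqrt (y i))\<^sup>2 \<le> (\<Sum>i\<in>S. 1\<^sup>2) * (\<Sum>i\<in>S. (sqrt (y i))\<^sup>2)"
    by (rule Cauchy_Schwarz_ineq_sum)
  also have "\<dots> = real (card S) * (\<Sum>i\<in>S. y i)"
    using assms by (intro arg_cong2[of _ _ _ _ "(*)"] sum.cong) auto
  finally show "(\<Sum>i\<in>S. sqrt (y i))\<^sup>2 \<le> real (card S) * (\<Sum>i\<in>S. y i)" by simp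
qed

text \<open>Multiply by \<open>(1 + x) ^ m\<close>, which is at least \<open>1 + m * x\<close>, and
  use \<open>(1 - x\<^sup>2) ^ m \<le> 1\<close>.\<close>

lemma one_minus_power_le:
  fixes x :: real
  assumes "0 \<le> x" "x \<le> 1"
  shows "(1 - x) ^ m \<le> 1 / (1 + real m * x)"
proof -
  have "1 + real m * x \<le> (1 + x) ^ m" using assms by (intro Bernoulli_inequality) auto
  then have "(1 - x) ^ m * (1 + real m * x) \<le> (1 - x) ^ m * (1 + x) ^ m"
    using assms by (intro mult_left_mono) auto
  also have "\<dots> = (1 - x\<^sup>2) ^ m"
    by (simp add: power_mult_distrib[symmetric] power2_eq_square algebra_simps)
  also have "\<dots> \<le> 1" using assms by (intro power_le_one) (auto simp: abs_square_le_1)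
  finally show ?thesis using assms by (simp add: pos_le_divide_eq add_pos_nonneg)
qed

section \<open>The mean gap as a sum of nonnegative terms, and the values expected to be hit
  often\<close>

context training
begin

lemma mean_gap_ge_sum:
  assumes "S \<subseteq> {1..n}" "\<And>i. i \<in> S \<Longrightarrow> w i \<le> d i * bias i * zero_visits (hits v i) (bias i)"
  shows "(\<Sum>i\<in>S. w i) \<le> mean_gap v"
proof -
  have "(\<Sum>i\<in>S. w i) \<le> (\<Sum>i\<in>S. d i * bias i * zero_visits (hits v i) (bias i))"
    using assms(2) by (rule sum_mono)
  also have "\<dots> \<le> mean_gap v"
    unfolding mean_gap_def using assms(1) by (intro sum_mono2 mult_nonneg_nonneg d_bias_nonneg zero_visits_nonneg abs_bias_le_1) auto
  finally show ?thesis .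
qed

text \<open>Both \<open>sqrt (hits v i)\<close> and \<open>1 / \<bar>bias i\<bar>\<close> are at
  least \<open>sg i / (2 * (sqrt (sg i / s) + \<bar>d i\<bar>))\<close>. Replacing their minimum by
  this quotient prepares for Cauchy-Schwarz; the constant is \<open>2 * 6\<close>.\<close>

lemma heavy_term_ge:
  assumes "0 < sg i" "0 < s" "real s * sg i / 4 \<le> real (hits v i)"
  shows "(d i)\<^sup>2 / (sqrt (sg i / real s) + \<bar>d i\<bar>) / 12 \<le> d i * bias i * zero_visits (hits v i) (bias i)"
proof (cases "d i = 0")
  case False
  define t where "t = real (hits v i)"
  define y where "y = sqrt (sg i / real s)"
  have y: "0 < y" using assms by (simp add: y_def)
  have "0 < real s * sg i" using assms by simp
  then have t: "0 < hits v i" using assms(3) by (cases "hits v i = 0") auto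
  have "sg i / (2 * y) = sqrt (real s * sg i / 4)"
  proof -
    have "(sg i / (2 * y))\<^sup>2 = real s * sg i / 4"
      using assms by (simp add: y_def power_divide power_mult_distrib) (simp add: power2_eq_square)
    then show ?thesis using assms y by (intro real_sqrt_unique[symmetric]) auto
  qed
  also have "\<dots> \<le> sqrt t" using assms(3) by (simp add: t_def)
  finally have sq: "sg i / (2 * y) \<le> sqrt t" .
  have "sg i / (2 * (y + \<bar>d i\<bar>)) \<le> min (sqrt t) (1 / \<bar>bias i\<bar>)"
  proof -
    have "sg i / (2 * (y + \<bar>d i\<bar>)) \<le> sg i / (2 * y)"
      using assms y by (intro divide_left_mono) auto
    also note sq
    finally have "sg i / (2 * (y + \<bar>d i\<bar>)) \<le> sqrt t" .
    moreover have "sg i / (2 * (y + \<bar>d i\<bar>)) \<le> sg i / \<bar>d i\<bar>"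
      using assms y False by (intro divide_left_mono) (auto intro!: mult_pos_pos add_pos_nonneg)
    ultimately show ?thesis using assms by (simp add: bias_def)
  qed
  also have "\<dots> / 6 \<le> zero_visits (hits v i) (bias i)"
    unfolding t_def using False assms t by (intro zero_visits_ge_min abs_bias_le_1) (auto simp: bias_def)
  finally have "sg i / (2 * (y + \<bar>d i\<bar>)) / 6 \<le> zero_visits (hits v i) (bias i)" by simp
  then have "d i * bias i * (sg i / (2 * (y + \<bar>d i\<bar>)) / 6) \<le> d i * bias i * zero_visits (hits v i) (bias i)"
    by (rule mult_left_mono[OF _ d_bias_nonneg])
  moreover have "d i * bias i * (sg i / (2 * (y + \<bar>d i\<bar>)) / 6) = (d i)\<^sup>2 / (y + \<bar>d i\<bar>) / 12"
    using assms by (simp add: bias_def power2_eq_square)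
  ultimately show ?thesis by (simp add: y_def)
qed simp

text \<open>Values hit at least half as often as expected contribute their weight
  \<open>w i\<close>. Markov's inequality bounds the weight lost on the others, and Cauchy-Schwarz
  bounds the total weight \<open>W\<close> from below.\<close>

lemma heavy_mean_gap:
  assumes S: "S \<subseteq> {1..n}" "\<And>i. i \<in> S \<Longrightarrow> 288 \<le> real s * (sg i / 2)"
    and \<epsilon>: "0 < \<epsilon>" "\<epsilon> \<le> (\<Sum>i\<in>S. \<bar>d i\<bar>)" and "0 < s"
  shows "measure_pmf.prob vals {v. mean_gap v < \<epsilon>\<^sup>2 / (24 * (sqrt (2 * real n / real s) + \<epsilon>))} \<le> 1 / 36"
proof -
  have fin: "finite S" using S(1) finite_subset by blast
  have pos: "0 < sg i" if "i \<in> S" for i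
    using S(2)[OF that] sg_nonneg[of i] by (cases "sg i = 0") auto
  define y where "y i = sqrt (sg i / real s) + \<bar>d i\<bar>" for i
  have y: "0 < y i" if "i \<in> S" for i
    using pos[OF that] assms(5) by (auto simp: y_def intro!: add_pos_nonneg)
  define w where "w i = (d i)\<^sup>2 / y i / 12" for i
  have w: "0 \<le> w i" if "i \<in> S" for i using y[OF that] by (simp add: w_def)
  define W where "W = (\<Sum>i\<in>S. w i)"
  define X where "X = (\<Sum>i\<in>S. \<bar>d i\<bar>)"
  define Y where "Y = sqrt (2 * real n / real s)"
  have X: "0 < X" using \<epsilon> by (simp add: X_def)
  \<comment> \<open>Concavity of the square root: at most \<open>n\<close> terms, whose masses sum
    to at most \<open>2\<close>.\<close>
  have sum_y: "(\<Sum>i\<in>S. y i) \<le> Y + X"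
  proof -
    have "(\<Sum>i\<in>S. sqrt (sg i / real s)) \<le> sqrt (real (card S) * (\<Sum>i\<in>S. sg i / real s))"
      using fin sg_nonneg by (intro sum_sqrt_le) auto
    also have "\<dots> \<le> sqrt (real n * (2 / real s))"
    proof (intro real_sqrt_le_mono mult_mono)
      show "real (card S) \<le> real n" using card_mono[OF _ S(1)] by simp
      have "(\<Sum>i\<in>S. sg i) \<le> 2" unfolding sum_sg[symmetric]
        using S(1) sg_nonneg by (intro sum_mono2) auto
      then show "(\<Sum>i\<in>S. sg i / real s) \<le> 2 / real s"
        unfolding sum_divide_distrib[symmetric] by (intro divide_right_mono) auto
    qed (use sg_nonneg in \<open>auto intro!: sum_nonneg\<close>)
    finally show ?thesis by (simp add: y_def Y_def X_def sum.distrib mult.commute)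
  qed
  have Wge: "\<epsilon>\<^sup>2 / (Y + \<epsilon>) \<le> 12 * W"
  proof -
    have Y0: "0 \<le> Y" by (simp add: Y_def)
    have "X\<^sup>2 \<le> (\<Sum>i\<in>S. \<bar>d i\<bar>\<^sup>2 / y i) * (\<Sum>i\<in>S. y i)"
      unfolding X_def by (rule Cauchy_Schwarz_Engel) (rule y)
    also have "(\<Sum>i\<in>S. \<bar>d i\<bar>\<^sup>2 / y i) = 12 * W"
      by (simp add: W_def w_def sum_distrib_left)
    finally have "X\<^sup>2 \<le> 12 * W * (\<Sum>i\<in>S. y i)" .
    also have "\<dots> \<le> 12 * W * (Y + X)"
      using sum_y w by (intro mult_left_mono) (auto simp: W_def intro!: sum_nonneg)
    finally have "X\<^sup>2 / (Y + X) \<le> 12 * W"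
      using X Y0 by (subst pos_divide_le_eq) auto
    \<comment> \<open>The map from \<open>x\<close> to \<open>x\<^sup>2 / (Y + x)\<close> is
      increasing, so \<open>X\<close> may be lowered to \<epsilon>.\<close>
    moreover have "\<epsilon>\<^sup>2 / (Y + \<epsilon>) \<le> X\<^sup>2 / (Y + X)"
    proof -
      have "\<epsilon>\<^sup>2 * Y \<le> X\<^sup>2 * Y" "\<epsilon> * (\<epsilon> * X) \<le> X * (\<epsilon> * X)"
        using \<epsilon> Y0 X by (auto intro!: mult_right_mono power_mono simp: X_def simp del: mult_le_cancel_right)
      then have "\<epsilon>\<^sup>2 * (Y + X) \<le> X\<^sup>2 * (Y + \<epsilon>)"
        by (simp add: power2_eq_square algebra_simps)
      then show ?thesis using \<epsilon>(1) X Y0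
        by (subst pos_divide_le_eq) (auto simp: pos_le_divide_eq)
    qed
    ultimately show ?thesis by linarith
  qed
  moreover have "0 < \<epsilon>\<^sup>2 / (Y + \<epsilon>)" using \<epsilon>(1) by (auto simp: Y_def intro!: divide_pos_pos add_nonneg_pos)
  ultimately have W: "0 < W" by linarith
  \<comment> \<open>Failure of the hypothesis of \<open>heavy_term_ge\<close>. The mean hit count is
    at least \<open>288\<close>, so the tail bound gives \<open>4 / 288 = 1 / 72\<close>.\<close>
  define bad where "bad i v = (if real (hits v i) < real s * (sg i / 2) / 2 then 1 else 0 :: real)" for i v
  have Ebad: "measure_pmf.expectation vals (bad i) \<le> 1 / 72" if "i \<in> S" for i
  proof -
    have i: "0 < i" using that S(1) by auto
    have "measure_pmf.expectation vals (bad i) =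
        measure_pmf.prob vals {v. real (hits v i) < real s * (sg i / 2) / 2}"
    proof -
      have "bad i = indicator {v. real (hits v i) < real s * (sg i / 2) / 2}"
        by (auto simp: bad_def fun_eq_iff indicator_def)
      then show ?thesis by simp
    qed
    also have "\<dots> = measure_pmf.prob (binomial_pmf s (sg i / 2)) {x. real x < real s * (sg i / 2) / 2}"
      unfolding hits_binomial[OF i, symmetric] by (simp add: vimage_def)
    also have "\<dots> \<le> 4 / (real s * (sg i / 2))"
      using S(2)[OF that] by (intro binomial_pmf_lower_tail sg_half_prob) auto
    also have "\<dots> \<le> 4 / 288"
      using S(2)[OF that] by (intro divide_left_mono) auto
    finally show ?thesis by simp
  qed
  have "measure_pmf.prob vals {v. mean_gap v < \<epsilon>\<^sup>2 / (24 * (Y + \<epsilon>))} \<le>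
      measure_pmf.prob vals {v. W / 2 \<le> (\<Sum>i\<in>S. w i * bad i v)}"
  proof (rule measure_pmf.finite_measure_mono, rule subsetI, unfold mem_Collect_eq)
    fix v assume mg: "mean_gap v < \<epsilon>\<^sup>2 / (24 * (Y + \<epsilon>))"
    have "(\<Sum>i\<in>S. w i - w i * bad i v) \<le> mean_gap v"
    proof (rule mean_gap_ge_sum[OF S(1)])
      fix i assume "i \<in> S"
      show "w i - w i * bad i v \<le> d i * bias i * zero_visits (hits v i) (bias i)"
      proof (cases "real (hits v i) < real s * (sg i / 2) / 2")
        case True
        then show ?thesis
          by (simp add: bad_def mult_nonneg_nonneg d_bias_nonneg zero_visits_nonneg abs_bias_le_1)
      next
        case False
        then show ?thesis
          using heavy_term_ge[OF pos[OF \<open>i \<in> S\<close>] assms(5), of v] by (simp add: bad_def w_def y_def)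
      qed
    qed
    then have "W - (\<Sum>i\<in>S. w i * bad i v) \<le> mean_gap v" by (simp add: sum_subtractf W_def)
    moreover have "mean_gap v < 12 * W / 24"
    proof -
      note mg
      also have "\<epsilon>\<^sup>2 / (24 * (Y + \<epsilon>)) = \<epsilon>\<^sup>2 / (Y + \<epsilon>) / 24" by simp
      also have "\<dots> \<le> 12 * W / 24" using Wge by (rule divide_right_mono) simp
      finally show ?thesis .
    qed
    ultimately show "W / 2 \<le> (\<Sum>i\<in>S. w i * bad i v)" by linarith
  qed simp
  \<comment> \<open>The expected lost weight is at most \<open>W / 72\<close>; half of
    \<open>W\<close> is therefore lost with probability at most \<open>1 / 36\<close>.\<close>
  also have "\<dots> \<le> measure_pmf.expectation vals (\<lambda>v. \<Sum>i\<in>S. w i * bad i v) / (W / 2)"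
    using W w by (intro Markov_finite_pmf finite_set_vals) (auto simp: bad_def intro!: sum_nonneg)
  also have "\<dots> \<le> (\<Sum>i\<in>S. w i * (1 / 72)) / (W / 2)"
    unfolding expectation_sum_finite_pmf[OF finite_set_vals] using W w Ebad
    by (intro divide_right_mono sum_mono) (auto intro!: mult_left_mono simp del: times_divide_eq_right)
  also have "\<dots> = 1 / 36"
    using W unfolding sum_distrib_right[symmetric] W_def[symmetric] by simp
  finally show ?thesis by (simp add: Y_def)
qed

section \<open>Values expected to be hit rarely\<close>

definition missed :: "nat \<Rightarrow> (nat \<Rightarrow> nat) \<Rightarrow> real" where
  "missed i v = (if hits v i = 0 then 1 else 0)"

lemma expectation_missed:
  assumes "0 < i"
  shows "measure_pmf.expectation vals (missed i) = (1 - sg i / 2) ^ s"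
proof -
  have "measure_pmf.expectation vals (missed i) =
      measure_pmf.expectation (binomial_pmf s (sg i / 2)) (\<lambda>x. if x = 0 then 1 else 0)"
    unfolding hits_binomial[OF assms, symmetric] by (simp add: missed_def[abs_def])
  also have "\<dots> = (\<Sum>x\<in>{0}. (if x = 0 then 1 else 0) * pmf (binomial_pmf s (sg i / 2)) x)"
    by (rule integral_measure_pmf_real) (auto split: if_splits)
  also have "\<dots> = (1 - sg i / 2) ^ s"
    using sg_half_prob[of i] by simp
  finally show ?thesis .
qed

lemma hits_eq_0_iff: "hits v i = 0 \<longleftrightarrow> (\<forall>j\<in>{..<s}. v j \<noteq> i)"
  by (auto simp: hits_def)

text \<open>A sample avoids both values with probability \<open>1 - x - y\<close>, which is at most
  \<open>(1 - x) * (1 - y)\<close>; take the power \<open>s\<close>.\<close>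

lemma missed_negative_correlation:
  assumes "0 < i" "0 < l" "i \<noteq> l"
  shows "measure_pmf.expectation vals (\<lambda>v. missed i v * missed l v) \<le>
    measure_pmf.expectation vals (missed i) * measure_pmf.expectation vals (missed l)"
proof -
  have pr: "measure_pmf.prob mix (- {i, l}) = 1 - sg i / 2 - sg l / 2"
    using measure_pmf.prob_compl[of "{i, l}" mix] assms(3)
    by (simp add: Compl_eq_Diff_UNIV measure_measure_pmf_finite pmf_mix)
  have "measure_pmf.expectation vals (\<lambda>v. missed i v * missed l v) =
      measure_pmf.expectation vals (indicator (Pi {..<s} (\<lambda>_. - {i, l})))"
    by (intro Bochner_Integration.integral_cong)
       (auto simp: missed_def hits_eq_0_iff indicator_def Pi_iff)
  also have "\<dots> = (1 - sg i / 2 - sg l / 2) ^ s"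
    unfolding vals_def by (simp add: measure_Pi_pmf_Pi pr)
  also have "\<dots> \<le> ((1 - sg i / 2) * (1 - sg l / 2)) ^ s"
  proof (rule power_mono)
    show "0 \<le> 1 - sg i / 2 - sg l / 2"
      unfolding pr[symmetric] by simp
    show "1 - sg i / 2 - sg l / 2 \<le> (1 - sg i / 2) * (1 - sg l / 2)"
      using mult_nonneg_nonneg[OF sg_nonneg[of i] sg_nonneg[of l]] by (simp add: algebra_simps)
  qed
  also have "\<dots> = measure_pmf.expectation vals (missed i) * measure_pmf.expectation vals (missed l)"
    using assms by (simp add: expectation_missed power_mult_distrib)
  finally show ?thesis .
qed

text \<open>A single hit already gives \<open>zero_visits\<close> at least \<open>1\<close>, so
  \<open>mean_gap\<close> dominates \<open>W\<close>, the sum of \<open>(d i)\<^sup>2 / sg i\<close>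
  over the values hit. Negative correlation controls the variance of \<open>W\<close>, and Chebyshev
  keeps it above half its mean.\<close>

lemma light_mean_gap:
  assumes S: "S \<subseteq> {1..n}" "\<And>i. i \<in> S \<Longrightarrow> 0 < sg i" "\<And>i. i \<in> S \<Longrightarrow> real s * (sg i / 2) \<le> 288"
    and \<epsilon>: "0 < \<epsilon>" "\<epsilon> \<le> (\<Sum>i\<in>S. \<bar>d i\<bar>)" and s: "0 < s"
    and large: "10 ^ 8 * real n \<le> (real s)\<^sup>2 * \<epsilon>\<^sup>2"
  shows "measure_pmf.prob vals {v. mean_gap v < real s * \<epsilon>\<^sup>2 / (1200 * real n)} \<le> 1 / 36"
proof -
  let ?E = "measure_pmf.expectation vals"
  note int = integrable_measure_pmf_finite[OF finite_set_vals]
  have fin: "finite S" using S(1) finite_subset by blast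
  have "S \<noteq> {}" using \<epsilon> by auto
  then have n: "0 < n" using S(1) by auto
  have i0: "0 < i" if "i \<in> S" for i using S(1) that by auto
  define a where "a i = (d i)\<^sup>2 / sg i" for i
  define f where "f i v = a i * (1 - missed i v)" for i v
  define W where "W v = (\<Sum>i\<in>S. f i v)" for v
  have a: "0 \<le> a i" for i using sg_nonneg[of i] by (simp add: a_def)
  have Ef: "?E (f i) = a i * (1 - ?E (missed i))" for i
    by (simp add: f_def[abs_def] int)
  have a_le: "a i \<le> 576 / real s" if "i \<in> S" for i
  proof -
    have "(d i)\<^sup>2 \<le> (sg i)\<^sup>2"
      using abs_d_le_sg[of i] sg_nonneg[of i] by (simp add: abs_le_square_iff[symmetric])
    then have "a i \<le> sg i" using S(2)[OF that] by (simp add: a_def divide_le_eq power2_eq_square)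
    also have "\<dots> \<le> 576 / real s" using S(3)[OF that] s by (simp add: field_simps)
    finally show ?thesis .
  qed
  \<comment> \<open>A summand is \<open>0\<close> or \<open>a i\<close>, so its square is
    \<open>a i\<close> times itself; \<open>a i \<le> 576 / s\<close> then bounds the variance by a
    multiple of the mean.\<close>
  have var: "measure_pmf.variance vals W \<le> 576 / real s * ?E W"
  proof -
    have "measure_pmf.variance vals W \<le> (\<Sum>i\<in>S. measure_pmf.variance vals (f i))"
      unfolding W_def
    proof (rule variance_sum_le_if_nonpos_correlated[OF finite_set_vals fin])
      fix i l assume il: "i \<in> S" "l \<in> S" "i \<noteq> l"
      have "?E (\<lambda>v. f i v * f l v) =
          ?E (\<lambda>v. (a i * a l) * (1 - missed i v - missed l v + missed i v * missed l v))"
        by (intro Bochner_Integration.integral_cong) (auto simp: f_def algebra_simps)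
      also have "\<dots> = (a i * a l) * (1 - ?E (missed i) - ?E (missed l) + ?E (\<lambda>v. missed i v * missed l v))"
        by (simp add: int)
      also have "\<dots> \<le> (a i * a l) * (1 - ?E (missed i) - ?E (missed l) + ?E (missed i) * ?E (missed l))"
        using missed_negative_correlation[of i l] il i0 a by (intro mult_left_mono) auto
      also have "\<dots> = ?E (f i) * ?E (f l)"
        unfolding Ef by (simp add: algebra_simps)
      finally show "?E (\<lambda>v. f i v * f l v) \<le> ?E (f i) * ?E (f l)" .
    qed
    also have "\<dots> \<le> (\<Sum>i\<in>S. 576 / real s * ?E (f i))"
    proof (rule sum_mono)
      fix i assume i: "i \<in> S"
      have "measure_pmf.variance vals (f i) = ?E (\<lambda>v. (f i v)\<^sup>2) - (?E (f i))\<^sup>2"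
        by (rule measure_pmf.variance_eq) (rule int)+
      also have "\<dots> \<le> ?E (\<lambda>v. (f i v)\<^sup>2)" by simp
      also have "\<dots> \<le> ?E (\<lambda>v. 576 / real s * f i v)"
      proof (rule expectation_mono_finite_pmf[OF finite_set_vals])
        fix v
        have "(f i v)\<^sup>2 = a i * f i v"
          by (simp add: f_def missed_def power2_eq_square)
        also have "\<dots> \<le> 576 / real s * f i v"
          using a_le[OF i] a[of i] by (intro mult_right_mono) (auto simp: f_def missed_def)
        finally show "(f i v)\<^sup>2 \<le> 576 / real s * f i v" .
      qed
      also have "\<dots> = 576 / real s * ?E (f i)" by (rule integral_mult_right_zero)
      finally show "measure_pmf.variance vals (f i) \<le> 576 / real s * ?E (f i)" .
    qed
    also have "\<dots> = 576 / real s * ?E W"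
      unfolding W_def expectation_sum_finite_pmf[OF finite_set_vals] sum_distrib_left ..
    finally show ?thesis .
  qed
  have EW: "real s * \<epsilon>\<^sup>2 / (600 * real n) \<le> ?E W"
  proof -
    have "real s / 600 * (d i)\<^sup>2 \<le> ?E (f i)" if i: "i \<in> S" for i
    proof -
      define x where "x = real s * (sg i / 2)"
      have x: "0 < x" "x \<le> 288" using S(2,3)[OF i] s by (auto simp: x_def)
      have "?E (missed i) \<le> 1 / (1 + x)"
        unfolding expectation_missed[OF i0[OF i]] x_def
        using sg_half_prob[of i] by (intro one_minus_power_le) auto
      then have "x / (1 + x) \<le> 1 - ?E (missed i)"
        using x by (simp add: field_simps)
      \<comment> \<open>Since \<open>x \<le> 288\<close>, the denominator \<open>1 + x\<close> is at
        most \<open>289\<close>: the hit probability is linear in \<open>x\<close> up to a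
        constant.\<close>
      moreover have "x / 300 \<le> x / (1 + x)"
        using x by (intro divide_left_mono) auto
      ultimately have "x / 300 \<le> 1 - ?E (missed i)" by linarith
      then have "a i * (x / 300) \<le> ?E (f i)"
        unfolding Ef using a by (rule mult_left_mono)
      moreover have "a i * (x / 300) = real s / 600 * (d i)\<^sup>2"
        using S(2)[OF i] by (simp add: a_def x_def)
      ultimately show ?thesis by (simp only:)
    qed
    then have "real s / 600 * (\<Sum>i\<in>S. (d i)\<^sup>2) \<le> ?E W"
      unfolding W_def expectation_sum_finite_pmf[OF finite_set_vals] sum_distrib_left
      by (rule sum_mono)
    moreover have "\<epsilon>\<^sup>2 / real n \<le> (\<Sum>i\<in>S. (d i)\<^sup>2)"
    proof -
      have "\<epsilon>\<^sup>2 \<le> (\<Sum>i\<in>S. \<bar>d i\<bar>)\<^sup>2" using \<epsilon> by (intro power_mono) auto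
      also have "\<dots> \<le> (\<Sum>i\<in>S. \<bar>d i\<bar>\<^sup>2 / 1) * (\<Sum>i\<in>S. 1)"
        by (rule Cauchy_Schwarz_Engel) simp
      also have "\<dots> \<le> (\<Sum>i\<in>S. (d i)\<^sup>2) * real n"
        using card_mono[OF _ S(1)] by (simp add: mult_left_mono sum_nonneg)
      finally show ?thesis using n by (simp add: divide_le_eq)
    qed
    then have "real s / 600 * (\<epsilon>\<^sup>2 / real n) \<le> real s / 600 * (\<Sum>i\<in>S. (d i)\<^sup>2)"
      by (rule mult_left_mono) simp
    ultimately have "real s / 600 * (\<epsilon>\<^sup>2 / real n) \<le> ?E W" by (rule order_trans[rotated])
    then show ?thesis by simp
  qed
  have pos: "0 < real s * \<epsilon>\<^sup>2 / (600 * real n)" using s n \<epsilon> by simp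
  then have EW0: "0 < ?E W" using EW by linarith
  have "measure_pmf.prob vals {v. mean_gap v < real s * \<epsilon>\<^sup>2 / (1200 * real n)} \<le>
      measure_pmf.prob vals {v. W v \<le> ?E W - ?E W / 2}"
  proof (rule measure_pmf.finite_measure_mono, rule subsetI, unfold mem_Collect_eq)
    fix v assume mg: "mean_gap v < real s * \<epsilon>\<^sup>2 / (1200 * real n)"
    have "W v \<le> mean_gap v"
      unfolding W_def
    proof (rule mean_gap_ge_sum[OF S(1)])
      fix i assume i: "i \<in> S"
      have ab: "a i = d i * bias i" by (simp add: a_def bias_def power2_eq_square)
      show "f i v \<le> d i * bias i * zero_visits (hits v i) (bias i)"
      proof (cases "hits v i = 0")
        case True
        then show ?thesis by (simp add: f_def missed_def zero_visits_def)
      next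
        case False
        then have "a i * 1 \<le> a i * zero_visits (hits v i) (bias i)"
          using a by (intro mult_left_mono zero_visits_ge_1 abs_bias_le_1) auto
        then show ?thesis using False by (simp add: f_def missed_def ab)
      qed
    qed
    also note mg
    also have "real s * \<epsilon>\<^sup>2 / (1200 * real n) = real s * \<epsilon>\<^sup>2 / (600 * real n) / 2" by simp
    also have "\<dots> \<le> ?E W / 2" using EW by (rule divide_right_mono) simp
    finally show "W v \<le> ?E W - ?E W / 2" by simp
  qed simp
  also have "\<dots> \<le> measure_pmf.variance vals W / (?E W / 2)\<^sup>2"
    using EW0 by (intro Chebyshev_lower_finite_pmf finite_set_vals) simp
  also have "\<dots> \<le> 576 / real s * ?E W / (?E W / 2)\<^sup>2"
    using var by (rule divide_right_mono) simp
  also have "\<dots> = 2304 / (real s * ?E W)"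
    using EW0 by (simp add: power2_eq_square)
  also have "\<dots> \<le> 2304 / (real s * (real s * \<epsilon>\<^sup>2 / (600 * real n)))"
    using EW s pos EW0 by (intro divide_left_mono mult_left_mono mult_pos_pos) auto
  also have "\<dots> = 2304 * 600 * real n / ((real s)\<^sup>2 * \<epsilon>\<^sup>2)"
    by (simp add: power2_eq_square)
  \<comment> \<open>\<open>36 * 2304 * 600 = 49766400\<close> is below the factor
    \<open>10 ^ 8\<close> of the hypothesis \<open>large\<close>.\<close>
  also have "\<dots> \<le> 1 / 36"
    using large s \<epsilon> by (subst pos_divide_le_eq) auto
  finally show ?thesis .
qed

text \<open>The absolute differences sum to twice the distance, at least
  \<open>2 * \<epsilon>\<close>, so the often hit or the rarely hit values carry at least
  \<epsilon>. Values of zero mass contribute nothing.\<close>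

lemma mean_gap_large:
  assumes "0 < \<epsilon>" "\<epsilon> \<le> dTV n P Q" "0 < s" and large: "10 ^ 8 * real n \<le> (real s)\<^sup>2 * \<epsilon>\<^sup>2"
  defines "\<delta> \<equiv> min (\<epsilon>\<^sup>2 / (24 * (sqrt (2 * real n / real s) + \<epsilon>))) (real s * \<epsilon>\<^sup>2 / (1200 * real n))"
  shows "measure_pmf.prob vals {v. mean_gap v < \<delta>} \<le> 1 / 36"
proof -
  define S where "S = {i \<in> {1..n}. 288 \<le> real s * (sg i / 2)}"
  define S' where "S' = {i \<in> {1..n}. real s * (sg i / 2) < 288 \<and> 0 < sg i}"
  have "(\<Sum>i\<in>S. \<bar>d i\<bar>) + (\<Sum>i\<in>S'. \<bar>d i\<bar>) = (\<Sum>i\<in>S \<union> S'. \<bar>d i\<bar>)"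
    by (subst sum.union_disjoint) (auto simp: S_def S'_def)
  also have "\<dots> = (\<Sum>i\<in>{1..n}. \<bar>d i\<bar>)"
  proof (rule sum.mono_neutral_left)
    show "\<forall>i\<in>{1..n} - (S \<union> S'). \<bar>d i\<bar> = 0"
      using sg_nonneg d_eq_0 by (fastforce simp: S_def S'_def less_le)
  qed (auto simp: S_def S'_def)
  also have "\<dots> \<ge> 2 * \<epsilon>" using assms(2) by (simp add: dTV_def d_def)
  finally consider "\<epsilon> \<le> (\<Sum>i\<in>S. \<bar>d i\<bar>)" | "\<epsilon> \<le> (\<Sum>i\<in>S'. \<bar>d i\<bar>)" by linarith
  then show ?thesis
  proof cases
    case 1
    have "measure_pmf.prob vals {v. mean_gap v < \<delta>} \<le>
        measure_pmf.prob vals {v. mean_gap v < \<epsilon>\<^sup>2 / (24 * (sqrt (2 * real n / real s) + \<epsilon>))}"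
      by (intro measure_pmf.finite_measure_mono) (auto simp: \<delta>_def)
    also have "\<dots> \<le> 1 / 36"
      by (rule heavy_mean_gap[OF _ _ assms(1) 1 assms(3)]) (auto simp: S_def)
    finally show ?thesis .
  next
    case 2
    have "measure_pmf.prob vals {v. mean_gap v < \<delta>} \<le>
        measure_pmf.prob vals {v. mean_gap v < real s * \<epsilon>\<^sup>2 / (1200 * real n)}"
      by (intro measure_pmf.finite_measure_mono) (auto simp: \<delta>_def)
    also have "\<dots> \<le> 1 / 36"
      by (rule light_mean_gap[OF _ _ _ assms(1) 2 assms(3) large]) (auto simp: S'_def)
    finally show ?thesis .
  qed
qed

text \<open>Three failures of probability \<open>1 / 36\<close> each: a large variance bound
  \<open>U\<close> (Markov, \<open>1152 = 36 * 32\<close>), a small conditional mean, and a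
  deviation of the gap by \<open>\<delta> / 2\<close> from it (Chebyshev,
  \<open>165888 = 36 * 4 * 1152\<close>).\<close>

lemma gap_large:
  assumes "0 < \<epsilon>" "\<epsilon> \<le> dTV n P Q" "0 < s" and large: "10 ^ 8 * real n \<le> (real s)\<^sup>2 * \<epsilon>\<^sup>2"
    and \<delta>: "0 < \<delta>" "\<delta> \<le> \<epsilon>\<^sup>2 / (24 * (sqrt (2 * real n / real s) + \<epsilon>))" "\<delta> \<le> real s * \<epsilon>\<^sup>2 / (1200 * real n)"
    and \<delta>_large: "165888 \<le> real s * \<delta>\<^sup>2"
  shows "measure_pmf.prob
    (bind_pmf (Pi_pmf {..<s} False (\<lambda>_. bernoulli_pmf (1 / 2)))
      (\<lambda>b. map_pmf (Pair b) (Pi_pmf {..<s} 0 (\<lambda>j. if b j then P else Q))))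
    {(b, v). gap b v < \<delta> / 2} \<le> 1 / 12"
proof -
  define U where "U v = (\<Sum>i\<in>{1..n}. 8 * (sg i)\<^sup>2 / (real (hits v i) + 1))" for v
  have "measure_pmf.prob vals {v. 1152 / real s \<le> U v} \<le> measure_pmf.expectation vals U / (1152 / real s)"
    using assms(3) by (intro Markov_finite_pmf finite_set_vals) (auto simp: U_def intro!: sum_nonneg)
  also have "\<dots> \<le> 32 / (real s + 1) / (1152 / real s)"
    unfolding U_def by (intro divide_right_mono expectation_variance_bound) auto
  also have "\<dots> \<le> 1 / 36" using assms(3) by (simp add: field_simps)
  finally have U: "measure_pmf.prob vals {v. 1152 / real s \<le> U v} \<le> 1 / 36" .
  have "measure_pmf.prob vals {v. mean_gap v < \<delta>} \<le>
      measure_pmf.prob vals {v. mean_gap v < min (\<epsilon>\<^sup>2 / (24 * (sqrt (2 * real n / real s) + \<epsilon>)))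
        (real s * \<epsilon>\<^sup>2 / (1200 * real n))}"
    using \<delta> by (intro measure_pmf.finite_measure_mono) auto
  also have "\<dots> \<le> 1 / 36" by (rule mean_gap_large[OF assms(1-3) large])
  finally have M: "measure_pmf.prob vals {v. mean_gap v < \<delta>} \<le> 1 / 36" .
  have "measure_pmf.prob vals ({v. 1152 / real s \<le> U v} \<union> {v. mean_gap v < \<delta>}) \<le> 2 / 36"
    using measure_Un_le[of "{v. 1152 / real s \<le> U v}" vals "{v. mean_gap v < \<delta>}"] U M
    by simp
  also have "{v. 1152 / real s \<le> U v} \<union> {v. mean_gap v < \<delta>} =
      {v. \<not> (U v < 1152 / real s \<and> \<delta> \<le> mean_gap v)}" by auto
  finally have G: "measure_pmf.prob vals {v. \<not> (U v < 1152 / real s \<and> \<delta> \<le> mean_gap v)} \<le> 2 / 36" .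
  have "measure_pmf.prob (bind_pmf vals (\<lambda>v. map_pmf (Pair v) (labels v)))
      (prod.swap -` {(b, v). gap b v < \<delta> / 2}) \<le> 2 / 36 + 1 / 36"
  proof (rule prob_bind_pmf_le[OF G])
    fix v assume v: "U v < 1152 / real s \<and> \<delta> \<le> mean_gap v"
    have "measure_pmf.prob (map_pmf (Pair v) (labels v)) (prod.swap -` {(b, v). gap b v < \<delta> / 2}) =
        measure_pmf.prob (labels v) {b. gap b v < \<delta> / 2}"
      by (simp add: vimage_def)
    also have "\<dots> \<le> measure_pmf.prob (labels v)
        {b. gap b v \<le> measure_pmf.expectation (labels v) (\<lambda>b. gap b v) - \<delta> / 2}"
      unfolding expectation_gap using v by (intro measure_pmf.finite_measure_mono) auto
    also have "\<dots> \<le> measure_pmf.variance (labels v) (\<lambda>b. gap b v) / (\<delta> / 2)\<^sup>2"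
      using \<delta>(1) by (intro Chebyshev_lower_finite_pmf finite_set_labels) auto
    also have "\<dots> \<le> (1152 / real s) / (\<delta> / 2)\<^sup>2"
      using variance_gap[of v] v by (intro divide_right_mono) (auto simp: U_def)
    also have "\<dots> = 4608 / (real s * \<delta>\<^sup>2)" by (simp add: power_divide)
    also have "\<dots> \<le> 1 / 36"
      using \<delta>_large by (subst pos_divide_le_eq) auto
    finally show "measure_pmf.prob (map_pmf (Pair v) (labels v)) (prod.swap -` {(b, v). gap b v < \<delta> / 2}) \<le> 1 / 36" .
  qed simp
  then show ?thesis unfolding labelled_samples_eq by simp
qed

end

subsection \<open>The testing phase\<close>

text \<open>Hoeffding's inequality for a block \<open>J\<close> of identically distributed
  coordinates. The summands range over an interval of length \<open>2\<close>, whence the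
  exponent.\<close>

lemma Hoeffding_Pi_pmf:
  fixes f :: "'b \<Rightarrow> real"
  assumes "finite I" "J \<subseteq> I" "J \<noteq> {}" "\<And>x. \<bar>f x\<bar> \<le> 1" "\<And>j. j \<in> J \<Longrightarrow> p j = q" "0 \<le> \<eta>"
  shows "measure_pmf.prob (Pi_pmf I dflt p)
      {\<omega>. real (card J) * \<eta> \<le> \<bar>(\<Sum>j\<in>J. f (\<omega> j)) - real (card J) * measure_pmf.expectation q f\<bar>}
    \<le> 2 * exp (- real (card J) * \<eta>\<^sup>2 / 2)"
proof -
  have fin: "finite J" using assms finite_subset by blast
  have c: "0 < real (card J)" using fin assms(3) by (simp add: card_gt_0_iff)
  interpret Hoeffding_ineq "measure_pmf (Pi_pmf I dflt p)" J "\<lambda>j \<omega>. f (\<omega> j)" "\<lambda>_. -1" "\<lambda>_. 1"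
    "\<Sum>j\<in>J. measure_pmf.expectation (Pi_pmf I dflt p) (\<lambda>\<omega>. f (\<omega> j))"
  proof unfold_locales
    show "prob_space.indep_vars (measure_pmf (Pi_pmf I dflt p)) (\<lambda>_. borel) (\<lambda>j \<omega>. f (\<omega> j)) J"
      by (rule prob_space.indep_vars_compose2[OF measure_pmf.prob_space_axioms
          prob_space.indep_vars_subset[OF measure_pmf.prob_space_axioms
            indep_vars_Pi_pmf[OF assms(1)] assms(2)]]) simp
    show "AE \<omega> in Pi_pmf I dflt p. f (\<omega> j) \<in> {-1..1}" for j
      using assms(4) by (intro AE_I2) (auto simp: abs_le_iff minus_le_iff)
  qed (rule fin)
  have "measure_pmf.expectation (Pi_pmf I dflt p) (\<lambda>\<omega>. f (\<omega> j)) = measure_pmf.expectation q f"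
    if "j \<in> J" for j
  proof -
    have "map_pmf (\<lambda>\<omega>. \<omega> j) (Pi_pmf I dflt p) = q"
      using that assms(2,5) by (auto simp: Pi_pmf_component[OF assms(1)])
    then show ?thesis by (metis integral_map_pmf)
  qed
  then have mu: "(\<Sum>j\<in>J. measure_pmf.expectation (Pi_pmf I dflt p) (\<lambda>\<omega>. f (\<omega> j))) =
      real (card J) * measure_pmf.expectation q f" by simp
  have "(real (card J) * \<eta>)\<^sup>2 / (2 * real (card J)) = real (card J) * \<eta>\<^sup>2 / 2"
    using c by (simp add: power2_eq_square)
  then show ?thesis
    using Hoeffding_ineq_abs_ge[of "real (card J) * \<eta>"] c assms(6) unfolding mu
    by (simp add: power2_eq_square mult_ac)
qed

definition all_sources :: "nat \<Rightarrow> source list" where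
  "all_sources k = SrcP # SrcQ # map SrcD [1..<k + 1]"

text \<open>Compares the empirical mean of \<open>f\<close> under the unknown source with the
  midpoint of those under \<open>P\<close> and \<open>Q\<close>, multiplied out to avoid division;
  \<open>True\<close> stands for \<open>P\<close>.\<close>

definition decide :: "nat \<Rightarrow> (nat \<Rightarrow> real) \<Rightarrow> (source \<times> nat \<Rightarrow> nat) \<Rightarrow> nat \<Rightarrow> bool" where
  "decide m f \<omega> i \<longleftrightarrow>
    (\<Sum>j<m. f (\<omega> (SrcP, j))) + (\<Sum>j<m. f (\<omega> (SrcQ, j))) < 2 * (\<Sum>j<m. f (\<omega> (SrcD i, j)))"

lemma distinct_all_sources: "distinct (all_sources k)"
  by (auto simp: all_sources_def distinct_map inj_on_def)

lemma length_all_sources: "length (all_sources k) = k + 2"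
  by (simp add: all_sources_def)

lemma set_all_sources: "set (all_sources k) = {SrcP, SrcQ} \<union> SrcD ` {1..k}"
  by (auto simp: all_sources_def)

text \<open>If all \<open>k + 2\<close> empirical means are within \<open>\<gamma> / 4\<close> of
  their expectations, each comparison is correct; a union bound over Hoeffding's inequality does the
  rest, with \<open>(\<gamma> / 4)\<^sup>2 / 2 = \<gamma>\<^sup>2 / 32\<close>.\<close>

lemma decide_error:
  assumes f: "\<And>x. \<bar>f x\<bar> \<le> 1" and "0 < m" "0 < \<gamma>"
    and gap: "\<gamma> \<le> measure_pmf.expectation P f - measure_pmf.expectation Q f"
    and D: "\<And>i. i \<in> {1..k} \<Longrightarrow> D i = P \<or> D i = Q"
  shows "measure_pmf.prob (Pi_pmf (set (all_sources k) \<times> {..<m}) 0 (\<lambda>j. env_of P Q D (fst j)))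
      {\<omega>. \<not> (\<forall>i\<in>{1..k}. decide m f \<omega> i = (D i = P))}
    \<le> real (k + 2) * (2 * exp (- real m * \<gamma>\<^sup>2 / 32))"
proof -
  define I where "I = set (all_sources k) \<times> {..<m}"
  define R where "R = Pi_pmf I 0 (\<lambda>j. env_of P Q D (fst j))"
  define score where "score \<omega> src = (\<Sum>j<m. f (\<omega> (src, j)))" for \<omega> :: "source \<times> nat \<Rightarrow> nat" and src
  define E where "E src = measure_pmf.expectation (env_of P Q D src) f" for src
  define Bad where "Bad src = {\<omega>. real m * (\<gamma> / 4) \<le> \<bar>score \<omega> src - real m * E src\<bar>}" for src
  have Bad: "measure_pmf.prob R (Bad src) \<le> 2 * exp (- real m * \<gamma>\<^sup>2 / 32)"
    if "src \<in> set (all_sources k)" for src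
  proof -
    have "(\<Sum>j\<in>{src} \<times> {..<m}. f (\<omega> j)) = score \<omega> src" for \<omega>
      unfolding score_def by (rule sum.reindex_bij_witness[of _ "Pair src" snd]) auto
    moreover have "card ({src} \<times> {..<m}) = m" by (simp add: card_cartesian_product)
    moreover have "{src} \<times> {..<m} \<subseteq> I" using that by (auto simp: I_def)
    moreover have "finite I" by (simp add: I_def)
    ultimately show ?thesis
      using Hoeffding_Pi_pmf[of I "{src} \<times> {..<m}" f "\<lambda>j. env_of P Q D (fst j)" "env_of P Q D src" "\<gamma> / 4" 0]
        that assms(2,3) f
      by (auto simp: R_def Bad_def E_def power_divide lessThan_empty_iff)
  qed
  have "{\<omega>. \<not> (\<forall>i\<in>{1..k}. decide m f \<omega> i = (D i = P))} \<subseteq> (\<Union>src\<in>set (all_sources k). Bad src)"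
  proof (rule subsetI, rule ccontr)
    fix \<omega> assume w: "\<omega> \<in> {\<omega>. \<not> (\<forall>i\<in>{1..k}. decide m f \<omega> i = (D i = P))}"
      and "\<omega> \<notin> (\<Union>src\<in>set (all_sources k). Bad src)"
    then have close: "\<bar>score \<omega> src - real m * E src\<bar> < real m * (\<gamma> / 4)"
      if "src \<in> set (all_sources k)" for src
      using that by (force simp: Bad_def)
    from w obtain i where i: "i \<in> {1..k}" "decide m f \<omega> i \<noteq> (D i = P)" by blast
    have P: "\<bar>score \<omega> SrcP - real m * E SrcP\<bar> < real m * (\<gamma> / 4)"
      and Q: "\<bar>score \<omega> SrcQ - real m * E SrcQ\<bar> < real m * (\<gamma> / 4)"
      and Di: "\<bar>score \<omega> (SrcD i) - real m * E (SrcD i)\<bar> < real m * (\<gamma> / 4)"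
      by (rule close; use i(1) in \<open>simp add: set_all_sources\<close>)+
    have "real m * \<gamma> \<le> real m * (E SrcP - E SrcQ)"
      using gap by (intro mult_left_mono) (auto simp: E_def env_of_def)
    then have g: "4 * (real m * (\<gamma> / 4)) \<le> real m * E SrcP - real m * E SrcQ"
      by (simp add: algebra_simps)
    have dec: "decide m f \<omega> i \<longleftrightarrow> score \<omega> SrcP + score \<omega> SrcQ < 2 * score \<omega> (SrcD i)"
      by (simp add: decide_def score_def)
    \<comment> \<open>The doubled score of the source and the scores of \<open>P\<close> and
      \<open>Q\<close> together err by less than \<open>m * \<gamma>\<close>, the least distance
      between twice the true mean and the sum of the two.\<close>
    show False
    proof (cases "D i = P")
      case True
      then have "real m * E (SrcD i) = real m * E SrcP" by (simp add: E_def env_of_def)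
      moreover have "2 * score \<omega> (SrcD i) \<le> score \<omega> SrcP + score \<omega> SrcQ"
        using i(2) True dec by auto
      ultimately show False using P Q Di g by linarith
    next
      case False
      with D[OF i(1)] have "real m * E (SrcD i) = real m * E SrcQ" by (simp add: E_def env_of_def)
      moreover have "score \<omega> SrcP + score \<omega> SrcQ < 2 * score \<omega> (SrcD i)"
        using i(2) False dec by auto
      ultimately show False using P Q Di g by linarith
    qed
  qed
  then have "measure_pmf.prob R {\<omega>. \<not> (\<forall>i\<in>{1..k}. decide m f \<omega> i = (D i = P))} \<le>
      measure_pmf.prob R (\<Union>src\<in>set (all_sources k). Bad src)"
    by (intro measure_pmf.finite_measure_mono) auto
  also have "\<dots> \<le> (\<Sum>src\<in>set (all_sources k). measure_pmf.prob R (Bad src))"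
    by (intro measure_UNION_le) auto
  also have "\<dots> \<le> (\<Sum>src\<in>set (all_sources k). 2 * exp (- real m * \<gamma>\<^sup>2 / 32))"
    by (intro sum_mono Bad)
  also have "\<dots> = real (k + 2) * (2 * exp (- real m * \<gamma>\<^sup>2 / 32))"
    using distinct_card[OF distinct_all_sources, of k] by (simp add: length_all_sources)
  finally show ?thesis by (simp add: R_def I_def)
qed

section \<open>Arithmetic of the sample bound\<close>

lemma k_ln_k_bounds:
  assumes "2 \<le> k"
  shows "real k \<le> 2 * (real k * ln (real k))" "1 \<le> real k * ln (real k)"
proof -
  have "ln 2 \<le> ln (real k)" using assms by simp
  then have l: "1 / 2 \<le> ln (real k)" using ln2_ge_two_thirds by linarith
  then show "real k \<le> 2 * (real k * ln (real k))"
    using mult_left_mono[OF l, of "real k"] by simp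
  then show "1 \<le> real k * ln (real k)" using assms by linarith
qed

text \<open>In every regime the bound dominates the expressions of all three regimes; cleared of
  roots and quotients, these are the three inequalities in \<open>B\<close>. The rest of the proof
  needs no case distinction on \<open>n\<close>.\<close>

lemma sc_bound_lower:
  assumes "2 \<le> k" "1 \<le> n" "0 < \<epsilon>" "\<epsilon> \<le> 1"
  defines "B \<equiv> sc_bound n k \<epsilon>" and "L \<equiv> real k * ln (real k)"
  shows "0 < B" "L \<le> B * \<epsilon>\<^sup>2" "real n * L \<le> B\<^sup>2 * \<epsilon> ^ 4" "(real n)\<^sup>2 * L \<le> B ^ 3 * \<epsilon> ^ 4"
proof -
  have L: "1 \<le> L" unfolding L_def by (rule k_ln_k_bounds[OF assms(1)])
  have e4: "0 < \<epsilon> ^ 4" "\<epsilon> ^ 4 \<le> 1" "(\<epsilon>\<^sup>2)\<^sup>2 = \<epsilon> ^ 4"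
    using assms by (auto intro: power_le_one)
  have e2: "0 < \<epsilon>\<^sup>2" "\<epsilon>\<^sup>2 \<le> 1" using assms by (auto intro: power_le_one)
  have n: "0 < real n" using assms by simp
  have sq: "a \<le> b" if "a\<^sup>2 \<le> b\<^sup>2" "0 \<le> b" for a b :: real
    using power2_le_imp_le that by blast
  have "0 < B \<and> L \<le> B * \<epsilon>\<^sup>2 \<and> real n * L \<le> B\<^sup>2 * \<epsilon> ^ 4 \<and> (real n)\<^sup>2 * L \<le> B ^ 3 * \<epsilon> ^ 4"
  proof -
    consider (1) "real n \<ge> L / \<epsilon> ^ 4" | (2) "real n < L / \<epsilon> ^ 4" "L \<le> real n" | (3) "real n < L / \<epsilon> ^ 4" "real n < L"
      by linarith
    then show ?thesis
    proof cases
      case 1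
      define X where "X = (real n)\<^sup>2 * L / \<epsilon> ^ 4"
      have X: "0 < X" using n L e4 by (simp add: X_def)
      have B: "B = X powr (1 / 3)" using 1 by (simp add: B_def sc_bound_def X_def L_def mult.assoc)
      have B0: "0 < B" using X by (simp add: B)
      have "B ^ 3 = X"
        using X by (simp add: B powr_powr flip: powr_realpow)
      then have B3: "B ^ 3 * \<epsilon> ^ 4 = (real n)\<^sup>2 * L" using e4 by (simp add: X_def)
      have nL: "L \<le> real n * \<epsilon> ^ 4" using 1 e4 by (simp add: pos_divide_le_eq)
      \<comment> \<open>Here the bound is at most \<open>n\<close>, so cancelling one factor of the
        cubic identity \<open>B3\<close> yields the quadratic inequality.\<close>
      have Bn: "B \<le> real n"
      proof (rule ccontr)
        assume "\<not> B \<le> real n"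
        then have "real n ^ 3 < B ^ 3" using n by (intro power_strict_mono) auto
        then have "real n ^ 3 * \<epsilon> ^ 4 < (real n)\<^sup>2 * L" unfolding B3[symmetric] using e4 by simp
        moreover have "(real n)\<^sup>2 * L \<le> (real n)\<^sup>2 * (real n * \<epsilon> ^ 4)" using nL by (intro mult_left_mono) auto
        ultimately show False by (simp add: power3_eq_cube power2_eq_square mult.assoc)
      qed
      have two: "real n * L \<le> B\<^sup>2 * \<epsilon> ^ 4"
      proof -
        have "real n * (real n * L) = B * (B\<^sup>2 * \<epsilon> ^ 4)"
          using B3 by (simp add: power3_eq_cube power2_eq_square mult.assoc)
        also have "\<dots> \<le> real n * (B\<^sup>2 * \<epsilon> ^ 4)" using Bn e4 by (intro mult_right_mono) auto
        finally show ?thesis using n by simp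
      qed
      have "L \<le> B * \<epsilon>\<^sup>2"
      proof (rule sq)
        have "real n * \<epsilon> ^ 4 \<le> real n" using n e4 by (simp add: mult_left_le)
        then have "L\<^sup>2 \<le> real n * L" using nL L by (simp add: power2_eq_square)
        then show "L\<^sup>2 \<le> (B * \<epsilon>\<^sup>2)\<^sup>2" using two e4 by (simp add: power_mult_distrib)
      qed (use B0 in simp)
      then show ?thesis using B0 two B3 by simp
    next
      case 2
      have B: "B = sqrt (real n * L) / \<epsilon>\<^sup>2" using 2 by (simp add: B_def sc_bound_def L_def mult.assoc)
      have B0: "0 < B" using n L e2 by (simp add: B)
      have B2: "B\<^sup>2 * \<epsilon> ^ 4 = real n * L" using n L e4 assms(3) by (simp add: B power_divide)
      have nL: "real n * \<epsilon> ^ 4 \<le> L" using 2 e4 by (simp add: pos_less_divide_eq)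
      \<comment> \<open>Conversely, here \<open>n\<close> is at most the bound, and multiplying the
        quadratic identity by it yields the cubic inequality.\<close>
      have "real n \<le> B"
      proof (rule sq)
        have "(real n)\<^sup>2 * \<epsilon> ^ 4 \<le> B\<^sup>2 * \<epsilon> ^ 4"
          unfolding B2 using nL n by (simp add: power2_eq_square mult.assoc)
        then show "(real n)\<^sup>2 \<le> B\<^sup>2" using e4 by simp
      qed (use B0 in simp)
      then have "real n * (real n * L) \<le> B * (B\<^sup>2 * \<epsilon> ^ 4)"
        unfolding B2 using n L by (intro mult_right_mono) auto
      then have three: "(real n)\<^sup>2 * L \<le> B ^ 3 * \<epsilon> ^ 4"
        by (simp add: power3_eq_cube power2_eq_square mult.assoc)
      have "L \<le> B * \<epsilon>\<^sup>2"
      proof (rule sq)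
        have "(B * \<epsilon>\<^sup>2)\<^sup>2 = real n * L" using B2 e4 by (simp add: power_mult_distrib)
        then show "L\<^sup>2 \<le> (B * \<epsilon>\<^sup>2)\<^sup>2" using 2 L by (simp add: power2_eq_square)
      qed (use B0 in simp)
      then show ?thesis using B0 B2 three by simp
    next
      case 3
      have B: "B = L / \<epsilon>\<^sup>2" using 3 by (simp add: B_def sc_bound_def L_def mult.assoc)
      have B0: "0 < B" using L e2 by (simp add: B)
      have B1: "B * \<epsilon>\<^sup>2 = L" using assms(3) by (simp add: B)
      have B2: "B\<^sup>2 * \<epsilon> ^ 4 = L * L"
        unfolding e4(3)[symmetric] power_mult_distrib[symmetric] B1 by (simp add: power2_eq_square)
      have "B * \<epsilon>\<^sup>2 \<le> B" using B0 e2 by simp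
      then have nB: "real n \<le> B" using B1 3 by linarith
      have two: "real n * L \<le> B\<^sup>2 * \<epsilon> ^ 4" unfolding B2 using 3 L by simp
      then have "real n * (real n * L) \<le> B * (B\<^sup>2 * \<epsilon> ^ 4)"
        using nB B0 n L by (intro mult_mono[OF nB two]) auto
      then have "(real n)\<^sup>2 * L \<le> B ^ 3 * \<epsilon> ^ 4"
        by (simp add: power3_eq_cube power2_eq_square mult.assoc)
      then show ?thesis using B0 B1 two by simp
    qed
  qed
  then show "0 < B" "L \<le> B * \<epsilon>\<^sup>2" "real n * L \<le> B\<^sup>2 * \<epsilon> ^ 4" "(real n)\<^sup>2 * L \<le> B ^ 3 * \<epsilon> ^ 4"
    by auto
qed

subsection \<open>The algorithm\<close>

text \<open>The factor makes \<open>1000000000 / 3456\<close> exceed the threshold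
  \<open>165888\<close> of \<open>gap_large\<close>.\<close>

definition training_size :: "nat \<Rightarrow> nat \<Rightarrow> real \<Rightarrow> nat" where
  "training_size n k \<epsilon> = nat \<lceil>1000000000 * sc_bound n k \<epsilon>\<rceil>"

text \<open>Samples per source: with \<open>k + 2\<close> sources, dividing by \<open>k\<close>
  keeps the total of order \<open>sc_bound\<close>.\<close>

definition testing_size :: "nat \<Rightarrow> nat \<Rightarrow> real \<Rightarrow> nat" where
  "testing_size n k \<epsilon> = nat \<lceil>10000000 * sc_bound n k \<epsilon> / real k\<rceil>"

text \<open>The fair coins are all the internal randomness, so they are drawn ahead of the
  deterministic tree.\<close>

definition multi_lfht :: "nat \<Rightarrow> nat \<Rightarrow> real \<Rightarrow> (source, nat \<Rightarrow> bool) qtree pmf" where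
  "multi_lfht n k \<epsilon> =
    (let s = training_size n k \<epsilon>; m = testing_size n k \<epsilon> in
      map_pmf (\<lambda>b. ask_all [0..<s] (\<lambda>j. if b j then SrcP else SrcQ)
          (\<lambda>v. ask_all (List.product (all_sources k) [0..<m]) fst
            (\<lambda>\<omega>. Done (decide m (vote s b v) \<omega>))))
        (Pi_pmf {..<s} False (\<lambda>_. bernoulli_pmf (1 / 2))))"

lemma run_multi_lfht:
  fixes n k \<epsilon>
  defines "s \<equiv> training_size n k \<epsilon>" and "m \<equiv> testing_size n k \<epsilon>"
  shows "bind_pmf (multi_lfht n k \<epsilon>) (run (env_of P Q D)) =
    bind_pmf (bind_pmf (Pi_pmf {..<s} False (\<lambda>_. bernoulli_pmf (1 / 2)))
        (\<lambda>b. map_pmf (Pair b) (Pi_pmf {..<s} 0 (\<lambda>j. if b j then P else Q))))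
      (\<lambda>(b, v). map_pmf (decide m (vote s b v))
        (Pi_pmf (set (all_sources k) \<times> {..<m}) 0 (\<lambda>j. env_of P Q D (fst j))))"
proof -
  have env: "env_of P Q D (if c then SrcP else SrcQ) = (if c then P else Q)" for c
    by (simp add: env_of_def)
  have "distinct (List.product (all_sources k) [0..<m])"
    by (simp add: distinct_product distinct_all_sources)
  then show ?thesis
    by (simp add: multi_lfht_def s_def[symmetric] m_def[symmetric] Let_def bind_map_pmf bind_assoc_pmf
        run_ask_all env map_pmf_def bind_return_pmf atLeast0LessThan set_product)
qed

text \<open>Rounding adds at most one training sample and \<open>k + 2\<close> testing samples,
  absorbed by \<open>1 \<le> B\<close> and \<open>k \<le> 2 * B\<close>.\<close>

lemma size_bounds:
  assumes "2 \<le> k" "1 \<le> n" "0 < \<epsilon>" "\<epsilon> \<le> 1"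
  defines "B \<equiv> sc_bound n k \<epsilon>"
  shows "1 \<le> B" "1000000000 * B \<le> real (training_size n k \<epsilon>)" "real (training_size n k \<epsilon>) \<le> 2 * 1000000000 * B"
    "10000000 * B / real k \<le> real (testing_size n k \<epsilon>)"
    "real (training_size n k \<epsilon>) + real (k + 2) * real (testing_size n k \<epsilon>) \<le> 3 * 1000000000 * B"
proof -
  note lb = sc_bound_lower[OF assms(1-4), folded B_def]
  note kl = k_ln_k_bounds[OF assms(1)]
  have "B * \<epsilon>\<^sup>2 \<le> B" using lb(1) assms by (simp add: mult_left_le power_le_one)
  then have LB: "real k * ln (real k) \<le> B" using lb(2) by linarith
  then show B: "1 \<le> B" using kl by linarith
  show "1000000000 * B \<le> real (training_size n k \<epsilon>)" "10000000 * B / real k \<le> real (testing_size n k \<epsilon>)"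
    unfolding training_size_def testing_size_def B_def by (rule of_nat_ceiling)+
  have s: "real (training_size n k \<epsilon>) \<le> 1000000000 * B + 1"
    unfolding training_size_def B_def[symmetric] using B by linarith
  then show "real (training_size n k \<epsilon>) \<le> 2 * 1000000000 * B" using B by linarith
  have "real (testing_size n k \<epsilon>) \<le> 10000000 * B / real k + 1"
  proof -
    have "0 \<le> 10000000 * B / real k" using B by simp
    then show ?thesis unfolding testing_size_def B_def[symmetric] by linarith
  qed
  then have "real (k + 2) * real (testing_size n k \<epsilon>) \<le> (2 * real k) * (10000000 * B / real k + 1)"
    using assms(1) by (intro mult_mono) auto
  also have "\<dots> = 2 * 10000000 * B + 2 * real k" using assms(1) by (simp add: distrib_left)
  finally show "real (training_size n k \<epsilon>) + real (k + 2) * real (testing_size n k \<epsilon>) \<le> 3 * 1000000000 * B"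
    using s LB kl B by linarith
qed

lemma within_samples_multi_lfht:
  assumes "2 \<le> k" "1 \<le> n" "0 < \<epsilon>" "\<epsilon> \<le> 1" "t \<in> set_pmf (multi_lfht n k \<epsilon>)"
  shows "within_samples t (3 * 1000000000 * sc_bound n k \<epsilon>)"
proof -
  have "real (training_size n k \<epsilon>) + (real k + 2) * real (testing_size n k \<epsilon>) \<le> 3 * 1000000000 * sc_bound n k \<epsilon>"
    using size_bounds(5)[OF assms(1-4)] by (simp add: add.commute)
  moreover have "0 \<le> (real k + 2) * real (testing_size n k \<epsilon>)" by simp
  ultimately have "real (training_size n k \<epsilon>) \<le> 3 * 1000000000 * sc_bound n k \<epsilon>"
    "(real k + 2) * real (testing_size n k \<epsilon>) \<le> 3 * 1000000000 * sc_bound n k \<epsilon> - real (training_size n k \<epsilon>)"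
    by linarith+
  then show ?thesis
    using assms(5) unfolding multi_lfht_def Let_def
    by (auto intro!: within_samples_ask_all simp: length_all_sources length_product algebra_simps)
qed

text \<open>The three lower bounds on \<open>sc_bound\<close> give \<open>s1\<close>,
  \<open>s2\<close> and \<open>s3\<close>. The often hit values need the first two, the rarely hit
  ones the third.\<close>

lemma separation_bounds:
  assumes "2 \<le> k" "1 \<le> n" "0 < \<epsilon>" "\<epsilon> \<le> 1"
  defines "s \<equiv> real (training_size n k \<epsilon>)" and "L \<equiv> real k * ln (real k)"
  defines "\<delta> \<equiv> min (\<epsilon>\<^sup>2 / (24 * (sqrt (2 * real n / s) + \<epsilon>))) (s * \<epsilon>\<^sup>2 / (1200 * real n))"
  shows "0 < \<delta>" "10 ^ 8 * real n \<le> s\<^sup>2 * \<epsilon>\<^sup>2" "1000000000 * L / 3456 \<le> s * \<delta>\<^sup>2"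
proof -
  define B where "B = sc_bound n k \<epsilon>"
  note lb = sc_bound_lower[OF assms(1-4), folded B_def L_def]
  have sB: "1000000000 * B \<le> s" unfolding s_def B_def by (rule size_bounds[OF assms(1-4)])
  have L: "1 \<le> L" unfolding L_def by (rule k_ln_k_bounds[OF assms(1)])
  have s: "0 < s" using sB lb(1) by linarith
  have n: "0 < real n" using assms by simp
  have s1: "1000000000 * L \<le> s * \<epsilon>\<^sup>2"
  proof -
    have "1000000000 * L \<le> 1000000000 * B * \<epsilon>\<^sup>2" using lb(2) by simp
    also have "\<dots> \<le> s * \<epsilon>\<^sup>2" using sB by (rule mult_right_mono) simp
    finally show ?thesis .
  qed
  have s2: "10 ^ 18 * (real n * L) \<le> s\<^sup>2 * \<epsilon> ^ 4"
  proof -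
    have "10 ^ 18 * (real n * L) \<le> (1000000000 * B)\<^sup>2 * \<epsilon> ^ 4" using lb(3) by (simp add: power_mult_distrib)
    also have "\<dots> \<le> s\<^sup>2 * \<epsilon> ^ 4" using sB lb(1) by (intro mult_right_mono power_mono) auto
    finally show ?thesis .
  qed
  have s3: "10 ^ 27 * ((real n)\<^sup>2 * L) \<le> s ^ 3 * \<epsilon> ^ 4"
  proof -
    have "10 ^ 27 * ((real n)\<^sup>2 * L) \<le> (1000000000 * B) ^ 3 * \<epsilon> ^ 4" using lb(4) by (simp add: power_mult_distrib)
    also have "\<dots> \<le> s ^ 3 * \<epsilon> ^ 4" using sB lb(1) by (intro mult_right_mono power_mono) auto
    finally show ?thesis .
  qed
  define \<delta>1 where "\<delta>1 = \<epsilon>\<^sup>2 / (24 * (sqrt (2 * real n / s) + \<epsilon>))"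
  define \<delta>2 where "\<delta>2 = s * \<epsilon>\<^sup>2 / (1200 * real n)"
  have den: "0 < sqrt (2 * real n / s) + \<epsilon>" using s assms(3) by (simp add: add_nonneg_pos)
  have d12: "0 < \<delta>1" "0 < \<delta>2" unfolding \<delta>1_def \<delta>2_def using den assms(3) s n by auto
  then show "0 < \<delta>" by (simp add: \<delta>_def \<delta>1_def \<delta>2_def)
  show "10 ^ 8 * real n \<le> s\<^sup>2 * \<epsilon>\<^sup>2"
  proof -
    have "real n * 1 \<le> real n * L" using L n by (intro mult_left_mono) auto
    then have "10 ^ 8 * real n \<le> 10 ^ 18 * (real n * L)" using n by simp
    also note s2
    also have "s\<^sup>2 * \<epsilon> ^ 4 \<le> s\<^sup>2 * \<epsilon>\<^sup>2"
      using assms(3,4) by (intro mult_left_mono power_decreasing) auto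
    finally show ?thesis .
  qed
  \<comment> \<open>Split \<open>(sqrt u + \<epsilon>)\<^sup>2 \<le> 2 * (u +
    \<epsilon>\<^sup>2)\<close>: \<open>s2\<close> handles the part with \<open>u\<close>,
    \<open>s1\<close> the part with \<open>\<epsilon>\<^sup>2\<close>. The constant is
    \<open>3456 = 6 * 24\<^sup>2\<close>.\<close>
  have "1000000000 * L / 3456 \<le> s * \<delta>1\<^sup>2"
  proof -
    define u where "u = 2 * real n / s"
    have u: "0 \<le> u" using s by (simp add: u_def)
    have "(sqrt u + \<epsilon>)\<^sup>2 \<le> 2 * (u + \<epsilon>\<^sup>2)"
    proof -
      have "2 * (sqrt u * \<epsilon>) \<le> (sqrt u)\<^sup>2 + \<epsilon>\<^sup>2"
        using sum_squares_bound[of "sqrt u" \<epsilon>] by simp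
      then show ?thesis using u by (simp add: power2_sum)
    qed
    moreover have "1000000000 * L * (u + \<epsilon>\<^sup>2) \<le> 3 * (s * \<epsilon> ^ 4)"
    proof -
      have "1000000000 * L * \<epsilon>\<^sup>2 \<le> s * \<epsilon>\<^sup>2 * \<epsilon>\<^sup>2" using s1 by (intro mult_right_mono) auto
      then have a: "1000000000 * L * \<epsilon>\<^sup>2 \<le> s * \<epsilon> ^ 4" by (simp add: power2_eq_square power4_eq_xxxx mult.assoc)
      have "1000000000 * (real n * L) \<le> s\<^sup>2 * \<epsilon> ^ 4"
        using s2 n L by (intro order_trans[OF _ s2] mult_right_mono) auto
      then have "1000000000 * L * real n / s \<le> s * \<epsilon> ^ 4"
        using s by (simp add: pos_divide_le_eq power2_eq_square mult_ac)
      then have b: "1000000000 * L * u \<le> 2 * (s * \<epsilon> ^ 4)" by (simp add: u_def)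
      show ?thesis using a b by (simp add: distrib_left)
    qed
    ultimately have "1000000000 * L * (sqrt u + \<epsilon>)\<^sup>2 \<le> 6 * (s * \<epsilon> ^ 4)"
    proof -
      assume a: "(sqrt u + \<epsilon>)\<^sup>2 \<le> 2 * (u + \<epsilon>\<^sup>2)" and b: "1000000000 * L * (u + \<epsilon>\<^sup>2) \<le> 3 * (s * \<epsilon> ^ 4)"
      have "1000000000 * L * (sqrt u + \<epsilon>)\<^sup>2 \<le> 1000000000 * L * (2 * (u + \<epsilon>\<^sup>2))"
        using a L by (intro mult_left_mono) auto
      also have "\<dots> = 2 * (1000000000 * L * (u + \<epsilon>\<^sup>2))" by simp
      finally show ?thesis using b by linarith
    qed
    then have "1000000000 * L / 6 \<le> s * \<epsilon> ^ 4 / (sqrt u + \<epsilon>)\<^sup>2"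
      using den by (simp add: pos_le_divide_eq u_def)
    then have "1000000000 * L / 6 / 576 \<le> s * \<epsilon> ^ 4 / (sqrt u + \<epsilon>)\<^sup>2 / 576"
      by (rule divide_right_mono) simp
    also have "\<dots> = s * \<delta>1\<^sup>2"
      by (simp add: \<delta>1_def u_def power_divide power_mult_distrib del: distrib_left_numeral)
    finally show ?thesis by simp
  qed
  moreover have "1000000000 * L / 3456 \<le> s * \<delta>2\<^sup>2"
  proof -
    have "10 ^ 27 * L \<le> s ^ 3 * \<epsilon> ^ 4 / (real n)\<^sup>2"
      using s3 n by (simp add: pos_le_divide_eq mult_ac)
    moreover have "s * \<delta>2\<^sup>2 = s ^ 3 * \<epsilon> ^ 4 / (real n)\<^sup>2 / 1440000"
      by (simp add: \<delta>2_def power_divide power_mult_distrib) (simp add: power2_eq_square power3_eq_cube)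
    ultimately show ?thesis using L by simp
  qed
  ultimately show "1000000000 * L / 3456 \<le> s * \<delta>\<^sup>2"
    unfolding \<delta>_def \<delta>1_def \<delta>2_def by (simp add: min_def)
qed

text \<open>Training fails with probability at most \<open>1 / 12\<close>; given good training,
  testing fails with probability at most \<open>1 / 36\<close>.\<close>

lemma multi_lfht_error:
  assumes "2 \<le> k" "1 \<le> n" "0 < \<epsilon>" "\<epsilon> \<le> 1"
    and "set_pmf P \<subseteq> {1..n}" "set_pmf Q \<subseteq> {1..n}" and dTV: "\<epsilon> \<le> dTV n P Q"
    and D: "\<And>i. i \<in> {1..k} \<Longrightarrow> D i = P \<or> D i = Q"
  shows "measure_pmf.prob (bind_pmf (multi_lfht n k \<epsilon>) (run (env_of P Q D)))
    {out. \<not> (\<forall>i\<in>{1..k}. out i = (D i = P))} \<le> 1 / 9"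
proof -
  define s where "s = training_size n k \<epsilon>"
  define m where "m = testing_size n k \<epsilon>"
  define B where "B = sc_bound n k \<epsilon>"
  define L where "L = real k * ln (real k)"
  interpret training n s P Q by unfold_locales (use assms in auto)
  define \<delta> where "\<delta> = min (\<epsilon>\<^sup>2 / (24 * (sqrt (2 * real n / real s) + \<epsilon>))) (real s * \<epsilon>\<^sup>2 / (1200 * real n))"
  note \<delta> = separation_bounds[OF assms(1-4), folded s_def L_def, folded \<delta>_def]
  note sz = size_bounds[OF assms(1-4), folded s_def m_def B_def]
  have L: "1 \<le> L" unfolding L_def by (rule k_ln_k_bounds[OF assms(1)])
  have s0: "0 < real s" using sz(1,2) by linarith
  have "0 < 10000000 * B / real k" using sz(1) assms(1) by simp
  then have m0: "0 < real m" using sz(4) by linarith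
  \<comment> \<open>The exponent in \<open>decide_error\<close> for the gap
    \<open>\<delta> / 2\<close>. As \<open>s\<close> is at most twice its target,
    \<open>6912 = 2 * 3456\<close>, and \<open>10000000 / 6912 / 128\<close> exceeds
    \<open>9\<close>.\<close>
  have md: "9 * ln (real k) \<le> real m * (\<delta> / 2)\<^sup>2 / 32"
  proof -
    have "1000000000 * L / 3456 \<le> (2 * 1000000000 * B) * \<delta>\<^sup>2"
      using \<delta>(3) mult_right_mono[OF sz(3), of "\<delta>\<^sup>2"] by simp
    then have "L / 6912 \<le> B * \<delta>\<^sup>2" by simp
    then have "10000000 / real k * (L / 6912) \<le> 10000000 / real k * (B * \<delta>\<^sup>2)"
      by (rule mult_left_mono) simp
    also have "\<dots> = 10000000 * B / real k * \<delta>\<^sup>2" by simp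
    also have "\<dots> \<le> real m * \<delta>\<^sup>2" using sz(4) by (rule mult_right_mono) simp
    also have "10000000 / real k * (L / 6912) = 10000000 / 6912 * ln (real k)"
      using assms(1) by (simp add: L_def)
    finally have "10000000 / 6912 * ln (real k) \<le> real m * \<delta>\<^sup>2" .
    moreover have "0 \<le> ln (real k)" using assms(1) by simp
    ultimately show ?thesis by (simp add: power_divide)
  qed
  \<comment> \<open>With \<open>k + 2 \<le> 2 * k\<close> the union bound is at most
    \<open>4 / k ^ 8\<close>, hence at most \<open>1 / 64\<close>.\<close>
  have tail: "real (k + 2) * (2 * exp (- real m * (\<delta> / 2)\<^sup>2 / 32)) \<le> 1 / 36"
  proof -
    have k: "0 < real k" using assms(1) by simp
    have "exp (- real m * (\<delta> / 2)\<^sup>2 / 32) \<le> exp (- (9 * ln (real k)))" using md by simp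
    also have "\<dots> = 1 / real k ^ 9"
      using k exp_of_nat_mult[of 9 "ln (real k)"] by (simp add: exp_minus inverse_eq_divide)
    finally have "real (k + 2) * (2 * exp (- real m * (\<delta> / 2)\<^sup>2 / 32)) \<le> (2 * real k) * (2 * (1 / real k ^ 9))"
      using assms(1) by (intro mult_mono) auto
    also have "\<dots> = 4 / real k ^ 8" using k by (simp add: power_Suc[of _ 8, simplified])
    also have "\<dots> \<le> 4 / 2 ^ 8" using assms(1) by (intro divide_left_mono power_mono) auto
    finally show ?thesis by simp
  qed
  have "measure_pmf.prob
    (bind_pmf (Pi_pmf {..<s} False (\<lambda>_. bernoulli_pmf (1 / 2)))
      (\<lambda>b. map_pmf (Pair b) (Pi_pmf {..<s} 0 (\<lambda>j. if b j then P else Q))))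
    {(b, v). gap b v < \<delta> / 2} \<le> 1 / 12"
    by (rule gap_large[OF assms(3) dTV _ \<delta>(2,1)]) (use s0 \<delta>(3) L in \<open>auto simp: \<delta>_def[symmetric]\<close>, auto simp: \<delta>_def)
  also have "{(b, v). gap b v < \<delta> / 2} = {bv. \<not> (\<delta> / 2 \<le> gap (fst bv) (snd bv))}" by auto
  finally have "measure_pmf.prob (bind_pmf (multi_lfht n k \<epsilon>) (run (env_of P Q D)))
      {out. \<not> (\<forall>i\<in>{1..k}. out i = (D i = P))} \<le> 1 / 12 + 1 / 36"
    unfolding run_multi_lfht s_def[symmetric] m_def[symmetric]
  proof (rule prob_bind_pmf_le)
    fix bv :: "(nat \<Rightarrow> bool) \<times> (nat \<Rightarrow> nat)"
    assume g: "\<delta> / 2 \<le> gap (fst bv) (snd bv)"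
    obtain b v where bv: "bv = (b, v)" by (cases bv)
    \<comment> \<open>By the support hypothesis the sum over \<open>{1..n}\<close> is the whole
      expectation, so \<open>gap b v\<close> is the difference of the means of the learned
      \<open>f\<close> under \<open>P\<close> and \<open>Q\<close>.\<close>
    have E: "measure_pmf.expectation R (vote s b v) = (\<Sum>i\<in>{1..n}. vote s b v i * pmf R i)"
      if "set_pmf R \<subseteq> {1..n}" for R
      using that by (intro integral_measure_pmf_real) auto
    have "gap b v = measure_pmf.expectation P (vote s b v) - measure_pmf.expectation Q (vote s b v)"
      using assms(5,6) by (simp add: E gap_def d_def sum_subtractf[symmetric] algebra_simps)
    then have "\<delta> / 2 \<le> measure_pmf.expectation P (vote s b v) - measure_pmf.expectation Q (vote s b v)"
      using g bv by simp
    from decide_error[OF _ _ _ this, of m k D] tail m0 \<delta>(1) D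
    show "measure_pmf.prob (case bv of (b, v) \<Rightarrow> map_pmf (decide m (vote s b v))
        (Pi_pmf (set (all_sources k) \<times> {..<m}) 0 (\<lambda>j. env_of P Q D (fst j))))
      {out. \<not> (\<forall>i\<in>{1..k}. out i = (D i = P))} \<le> 1 / 36"
      by (auto simp: bv vimage_def vote_def abs_sgn_eq intro: order_trans)
  qed simp
  then show ?thesis by simp
qed

theorem theorem3p1:
  shows "\<exists>C>0. \<exists>A :: nat \<Rightarrow> nat \<Rightarrow> real \<Rightarrow> (source, nat \<Rightarrow> bool) qtree pmf.
    \<forall>n k \<epsilon> P Q D.
      k \<ge> 2 \<longrightarrow> n \<ge> 1 \<longrightarrow> 0 < \<epsilon> \<longrightarrow> \<epsilon> \<le> 1 \<longrightarrow>
      set_pmf P \<subseteq> {1..n} \<longrightarrow> set_pmf Q \<subseteq> {1..n} \<longrightarrow>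
      dTV n P Q \<ge> \<epsilon> \<longrightarrow>
      (\<forall>i\<in>{1..k}. set_pmf (D i) \<subseteq> {1..n} \<and> (D i = P \<or> D i = Q)) \<longrightarrow>
        (\<forall>t\<in>set_pmf (A n k \<epsilon>). within_samples t (C * sc_bound n k \<epsilon>)) \<and>
        measure_pmf.prob (bind_pmf (A n k \<epsilon>) (run (env_of P Q D)))
          {out. \<forall>i\<in>{1..k}. out i = (D i = P)} \<ge> 8/9"
\<comment> \<open>The constant is the one of \<open>size_bounds\<close>, covering both
  phases.\<close>
proof (intro exI[of _ "3 * 1000000000"] exI[of _ multi_lfht] conjI allI impI ballI)
  fix n k :: nat and \<epsilon> :: real and P Q :: "nat pmf" and D :: "nat \<Rightarrow> nat pmf"
  assume *: "2 \<le> k" "1 \<le> n" "0 < \<epsilon>" "\<epsilon> \<le> 1" "set_pmf P \<subseteq> {1..n}" "set_pmf Q \<subseteq> {1..n}"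
    "\<epsilon> \<le> dTV n P Q" "\<forall>i\<in>{1..k}. set_pmf (D i) \<subseteq> {1..n} \<and> (D i = P \<or> D i = Q)"
  show "within_samples t (3 * 1000000000 * sc_bound n k \<epsilon>)" if "t \<in> set_pmf (multi_lfht n k \<epsilon>)" for t
    using within_samples_multi_lfht[OF *(1-4) that] .
  define R where "R = bind_pmf (multi_lfht n k \<epsilon>) (run (env_of P Q D))"
  have "measure_pmf.prob R {out. \<not> (\<forall>i\<in>{1..k}. out i = (D i = P))} \<le> 1 / 9"
    unfolding R_def by (rule multi_lfht_error[OF *(1-7)]) (use *(8) in auto)
  moreover have "measure_pmf.prob R {out. \<forall>i\<in>{1..k}. out i = (D i = P)} =
      1 - measure_pmf.prob R {out. \<not> (\<forall>i\<in>{1..k}. out i = (D i = P))}"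
    using measure_pmf.prob_compl[of "{out. \<not> (\<forall>i\<in>{1..k}. out i = (D i = P))}" R]
    by (simp add: set_diff_eq)
  ultimately show "8 / 9 \<le> measure_pmf.prob R {out. \<forall>i\<in>{1..k}. out i = (D i = P)}"
    by linarith
qed simp

end
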